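(* Let $\alpha\ge 0$, let $u\in \mathcal{C}[-1,1]\cap\mathcal{BV}[-1,1]$, and let $(N_n)_{n\in\mathbb{N}}$ be any sequence of natural numbers with $$\frac{n^{3+\alpha+\max\{1,\alpha\}}}{N_n}\to 0\qquad(n\to\infty).$$ Then for each $x\in[-1,1]$ for which $$\sum_{k=0}^n \frac{(u,P_k)_\varrho}{(P_k,P_k)_\varrho}\,P_k(x)\to u(x)\qquad (n\to\infty),$$ one has, with $N=N_n$, $$\sum_{k=0}^n \frac{\langle u,Q_k\rangle_\omega}{\langle Q_k,Q_k\rangle_\omega}\,Q_k\!\left(\tfrac{N_n}2(1+x)\right)\to u(x)\qquad (n\to\infty).$$
   Context: $\mathcal{BV}[-1,1]$ is the set of real functions on $[-1,1]$ of finite total variation. Binomial coefficients with real entries are defined via the Gamma function. $P_k=P_k^{\alpha,\alpha}$ is the Jacobi polynomial of degree $k$ with both parameters equal to $\alpha$, normalized by $P_k(1)=\binom{k+\alpha}{k}$. It is orthogonal with respect to $(f,g)_\varrho=\int_{-1}^1 f(x)g(x)\varrho(x)\,dx$, $\varrho(x)=(1-x)^\alpha(1+x)^\alpha$. For $N\in\mathbb{N}$, $Q_k=Q_k(\cdot;\alpha,\alpha,N)$ is the Hahn polynomial of degree $k$ ($0\le k\le N$), where $Q_k(y;\alpha,\beta,N)=\sum_{j=0}^k\frac{(-k)_j(k+\alpha+\beta+1)_j(-y)_j}{(\alpha+1)_j(-N)_j\,j!}$ and $(a)_j=a(a+1)\cdots(a+j-1)$. These are orthogonal with respect to $\langle f,g\rangle_\omega=\sum_{i=0}^N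 f(i)g(i)\omega(i)$, $\omega(i)=\binom{\alpha+i}{i}\binom{\alpha+N-i}{N-i}$. In the claim, for each $n$ the polynomials $Q_k$ and the inner product are taken with $N=N_n$; the Hahn sum is defined when $n\le N_n$, which holds for all sufficiently large $n$. A function $u$ on $[-1,1]$ appearing in $\langle\cdot,\cdot\rangle_\omega$ is identified with $i\mapsto u(2i/N-1)$, so $\langle u,Q_k\rangle_\omega=\sum_{i=0}^N u(2i/N-1)Q_k(i)\omega(i)$. *)

theory Defs
  imports "HOL-Analysis.Analysis"
begin

definition total_variation :: "(real \<Rightarrow> real) \<Rightarrow> real \<Rightarrow> real \<Rightarrow> ereal" where
  "total_variation f a b =
     (SUP (n, t) \<in> {(n :: nat, t :: nat \<Rightarrow> real). t 0 = a \<and> t n = b \<and> (\<forall>i<n. t i < t (Suc i))}.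
        ereal (\<Sum>i<n. \<bar>f (t (Suc i)) - f (t i)\<bar>))"

text \<open>Only the values of a function on the interval matter; outside it the function is arbitrary.\<close>

definition BV :: "real \<Rightarrow> real \<Rightarrow> (real \<Rightarrow> real) set" where
  "BV a b = {f. total_variation f a b < \<infinity>}"

definition gamma_binomial :: "real \<Rightarrow> real \<Rightarrow> real" where
  "gamma_binomial x y = Gamma (x + 1) / (Gamma (y + 1) * Gamma (x - y + 1))"

lemma gamma_binomial_eq_gchoose:
  assumes "a \<ge> 0"
  shows "gamma_binomial (a + real k) (real k) = (a + real k) gchoose k"
proof -
  have "a + real k + 1 \<notin> \<int>\<^sub>\<le>\<^sub>0"
    using assms by (auto elim!: nonpos_Ints_cases)
  then show ?thesis
    by (simp add: gamma_binomial_def gbinomial_Gamma Gamma_fact add.commute)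
qed

text \<open>
  The standard hypergeometric form
  \<open>P\<^sub>k(x) = binom(k + \<alpha>, k) \<cdot> \<^sub>2F\<^sub>1(-k, k + \<alpha> + \<beta> + 1; \<alpha> + 1; (1 - x) / 2)\<close>
  of the Jacobi polynomials.
\<close>

definition jacobi_poly :: "real \<Rightarrow> real \<Rightarrow> nat \<Rightarrow> real \<Rightarrow> real" where
  "jacobi_poly \<alpha> \<beta> k x =
     gamma_binomial (real k + \<alpha>) (real k) *
     (\<Sum>j\<le>k. pochhammer (- real k) j * pochhammer (real k + \<alpha> + \<beta> + 1) j
               / (pochhammer (\<alpha> + 1) j * fact j) * ((1 - x) / 2) ^ j)"

lemma jacobi_poly_at_1: "jacobi_poly \<alpha> \<beta> k 1 = gamma_binomial (real k + \<alpha>) (real k)"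
proof -
  have "(\<Sum>j\<le>k. pochhammer (- real k) j * pochhammer (real k + \<alpha> + \<beta> + 1) j
               / (pochhammer (\<alpha> + 1) j * fact j) * ((1 - 1) / 2) ^ j) =
        (\<Sum>j\<le>k. if j = 0 then 1 else 0)"
    by (intro sum.cong) auto
  then show ?thesis
    by (simp add: jacobi_poly_def)
qed

text \<open>
  For \<open>\<alpha> = 0\<close> the convention \<open>0 powr 0 = 0\<close> gives the value 0 instead of 1 at the
  two end points; this does not affect integrals.
\<close>

definition jacobi_weight :: "real \<Rightarrow> real \<Rightarrow> real" where
  "jacobi_weight \<alpha> x = (1 - x) powr \<alpha> * (1 + x) powr \<alpha>"

definition jacobi_inner :: "real \<Rightarrow> (real \<Rightarrow> real) \<Rightarrow> (real \<Rightarrow> real) \<Rightarrow> real" where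
  "jacobi_inner \<alpha> f g = integral {-1..1} (\<lambda>x. f x * g x * jacobi_weight \<alpha> x)"

text \<open>
  \<open>hahn_poly \<alpha> \<beta> N k\<close> is meaningful for \<open>k \<le> N\<close> only: otherwise some factors
  \<open>pochhammer (- N) j\<close> vanish, and the corresponding quotients are 0 by convention.
\<close>

definition hahn_poly :: "real \<Rightarrow> real \<Rightarrow> nat \<Rightarrow> nat \<Rightarrow> real \<Rightarrow> real" where
  "hahn_poly \<alpha> \<beta> N k y =
     (\<Sum>j\<le>k. pochhammer (- real k) j * pochhammer (real k + \<alpha> + \<beta> + 1) j * pochhammer (- y) j
               / (pochhammer (\<alpha> + 1) j * pochhammer (- real N) j * fact j))"

definition hahn_weight :: "real \<Rightarrow> nat \<Rightarrow> nat \<Rightarrow> real" where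
  "hahn_weight \<alpha> N i =
     gamma_binomial (\<alpha> + real i) (real i) * gamma_binomial (\<alpha> + real (N - i)) (real (N - i))"

definition hahn_inner :: "real \<Rightarrow> nat \<Rightarrow> (nat \<Rightarrow> real) \<Rightarrow> (nat \<Rightarrow> real) \<Rightarrow> real" where
  "hahn_inner \<alpha> N f g = (\<Sum>i\<le>N. f i * g i * hahn_weight \<alpha> N i)"

definition on_grid :: "nat \<Rightarrow> (real \<Rightarrow> real) \<Rightarrow> nat \<Rightarrow> real" where
  "on_grid N u i = u (2 * real i / real N - 1)"

definition jacobi_sum :: "real \<Rightarrow> (real \<Rightarrow> real) \<Rightarrow> nat \<Rightarrow> real \<Rightarrow> real" where
  "jacobi_sum \<alpha> u n x =
     (\<Sum>k\<le>n. jacobi_inner \<alpha> u (jacobi_poly \<alpha> \<alpha> k)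
               / jacobi_inner \<alpha> (jacobi_poly \<alpha> \<alpha> k) (jacobi_poly \<alpha> \<alpha> k)
               * jacobi_poly \<alpha> \<alpha> k x)"

definition hahn_sum :: "real \<Rightarrow> nat \<Rightarrow> (real \<Rightarrow> real) \<Rightarrow> nat \<Rightarrow> real \<Rightarrow> real" where
  "hahn_sum \<alpha> N u n x =
     (\<Sum>k\<le>n. hahn_inner \<alpha> N (on_grid N u) (\<lambda>i. hahn_poly \<alpha> \<alpha> N k (real i))
               / hahn_inner \<alpha> N (\<lambda>i. hahn_poly \<alpha> \<alpha> N k (real i)) (\<lambda>i. hahn_poly \<alpha> \<alpha> N k (real i))
               * hahn_poly \<alpha> \<alpha> N k (real N / 2 * (1 + x)))"

end

theory Submission
  imports Defs
begin

text \<open>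
  Substitute \<open>t = (1 + x) / 2\<close>, put \<open>w(t) = t\<^sup>\<alpha> (1 - t)\<^sup>\<alpha>\<close>, and let \<open>p\<^sub>k\<close> be the Jacobi
  polynomial for \<open>w\<close> on \<open>[0, 1]\<close> with \<open>p\<^sub>k(0) = 1\<close>. Write \<open>h\<^sub>k\<close> for its squared norm and
  \<open>\<lambda>\<^sub>k = k (k + 2\<alpha> + 1)\<close> for its eigenvalue. What ties the Hahn polynomials \<open>Q\<^sub>k\<close> to the \<open>p\<^sub>k\<close> is
  the Bernstein operator \<open>B\<close>, which maps a function on the grid \<open>{0, ..., N}\<close> to a polynomial.
  
  The Hahn weight at \<open>i\<close> is a constant multiple of \<open>\<integral> b\<^sub>N\<^sub>,\<^sub>i w\<close>, where \<open>b\<^sub>N\<^sub>,\<^sub>i\<close> is the Bernstein basis.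
  Up to that constant, \<open>B\<close> therefore has as its adjoint the map \<open>S\<close> that sends \<open>f\<close> to its means with
  respect to the Beta densities proportional to \<open>b\<^sub>N\<^sub>,\<^sub>i w\<close> (\<open>hahn_jacobi_duality\<close>). The factorial
  moments of the binomial distribution give \<open>B Q\<^sub>k = p\<^sub>k\<close> (\<open>bernstein_op_hahn\<close>). Since \<open>B\<close> and \<open>S\<close>
  do not raise degrees, \<open>B S p\<^sub>k\<close> is orthogonal to all lower degrees, hence a multiple of
  \<open>p\<^sub>k = B Q\<^sub>k\<close>, and \<open>S p\<^sub>k = \<mu>\<^sub>k Q\<^sub>k\<close> because \<open>B\<close> is injective (\<open>beta_sample_jacobi\<close>). This has two
  consequences. The \<open>k\<close>-th Hahn coefficient of \<open>u\<close> is exactly the \<open>k\<close>-th Jacobi coefficient of \<open>B u\<close>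
  (\<open>hahn_coefficient\<close>); and \<open>Q\<^sub>k(N t)\<close>, also for \<open>N t\<close> off the grid, is up to the factor \<open>\<mu>\<^sub>k\<close> a mean
  of \<open>p\<^sub>k\<close> over a Beta density with mean close to \<open>t\<close> and variance of order \<open>1 / N\<close>.
  
  The \<open>k\<close>-th terms of the two expansions thus differ by
  \<open>(B u - u, p\<^sub>k) / h\<^sub>k \<cdot> Q\<^sub>k + (u, p\<^sub>k) / h\<^sub>k \<cdot> (Q\<^sub>k - p\<^sub>k)\<close>, and both summands are small.
  A Beta mean of a function \<open>F\<close> differs from the value of \<open>F\<close> at the mean by at most \<open>sup t (1 - t) |F''|\<close>
  divided by roughly \<open>N\<close> (\<open>beta_mean_error\<close>). For \<open>F = p\<^sub>k\<close> the differential equation bounds this by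
  \<open>\<lambda>\<^sub>k / N\<close>, which gives \<open>Q\<^sub>k - p\<^sub>k = O(k\<^sup>2 / N)\<close> (\<open>hahn_poly_close\<close>). For \<open>B u - u\<close>, a summation by parts
  leaves the increments of \<open>u\<close> over the grid multiplied by such an error for the primitive \<open>F\<close> of
  \<open>w p\<^sub>k\<close>; as \<open>t (1 - t) p\<^sub>k'\<close> is \<open>O(k)\<close>, this gives \<open>(B u - u, p\<^sub>k) = O(k / N)\<close> times the variation of
  \<open>u\<close> (\<open>bernstein_quadrature\<close>). Finally \<open>1 / h\<^sub>k = O(k\<^sup>2\<^sup>\<alpha>\<^sup>+\<^sup>1)\<close>, and \<open>(u, p\<^sub>k) = O(\<surd>h\<^sub>k)\<close> by
  Cauchy-Schwarz. Summing over \<open>k \<le> n\<close>, the expansions differ by \<open>O(n powr (2\<alpha> + 3) / N)\<close> plus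
  \<open>O(n powr (\<alpha> + 7/2) / N)\<close>, and neither exponent exceeds \<open>3 + \<alpha> + max 1 \<alpha>\<close>.
\<close>

section \<open>Power weights on the unit interval\<close>

text \<open>
  Unlike \<open>powr\<close>, where \<open>0 powr 0 = 0\<close>, this power is continuous at \<open>0\<close> also for the exponent \<open>0\<close>.
  The weights below are then continuous on the closed interval for all exponents \<open>\<ge> 0\<close>.
\<close>

definition cpow :: "real \<Rightarrow> real \<Rightarrow> real" where
  "cpow a t = (if a = 0 then 1 else t powr a)"

definition beta_weight :: "real \<Rightarrow> real \<Rightarrow> real \<Rightarrow> real" where
  "beta_weight a b t = cpow a t * cpow b (1 - t)"

lemma cpow_eq_powr: "0 < t \<Longrightarrow> cpow a t = t powr a"
  by (simp add: cpow_def)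

lemma continuous_on_cpow: "a \<ge> 0 \<Longrightarrow> continuous_on {0..} (cpow a)"
  unfolding cpow_def by (cases "a = 0") (auto intro!: continuous_intros continuous_on_powr')

lemma cpow_add: "a \<ge> 0 \<Longrightarrow> b \<ge> 0 \<Longrightarrow> t \<ge> 0 \<Longrightarrow> cpow (a + b) t = cpow a t * cpow b t"
  by (auto simp: cpow_def powr_add)

lemma cpow_of_nat: "t \<ge> 0 \<Longrightarrow> cpow (real n) t = t ^ n"
  by (cases "t = 0") (auto simp: cpow_def powr_realpow)

lemma cpow_nonneg: "t \<ge> 0 \<Longrightarrow> cpow a t \<ge> 0"
  by (simp add: cpow_def)

lemma cpow_le_1: "a \<ge> 0 \<Longrightarrow> t \<in> {0..1} \<Longrightarrow> cpow a t \<le> 1"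
  by (auto simp: cpow_def powr_le1)

lemma continuous_on_beta_weight [continuous_intros]:
  assumes "a \<ge> 0" "b \<ge> 0"
  shows "continuous_on {0..1} (beta_weight a b)"
proof -
  have "continuous_on {0..1} (\<lambda>t. cpow b (1 - t))"
    by (rule continuous_on_compose2[OF continuous_on_cpow[OF assms(2)]])
       (auto intro!: continuous_intros)
  moreover have "continuous_on {0..1} (cpow a)"
    by (rule continuous_on_subset[OF continuous_on_cpow[OF assms(1)]]) auto
  ultimately show ?thesis
    unfolding beta_weight_def by (intro continuous_intros)
qed

lemma beta_weight_nonneg: "t \<in> {0..1} \<Longrightarrow> beta_weight a b t \<ge> 0"
  by (auto simp: beta_weight_def cpow_nonneg)

lemma beta_weight_le_1: "a \<ge> 0 \<Longrightarrow> b \<ge> 0 \<Longrightarrow> t \<in> {0..1} \<Longrightarrow> beta_weight a b t \<le> 1"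
  unfolding beta_weight_def by (intro mult_le_one) (auto intro: cpow_le_1 cpow_nonneg)

lemma beta_weight_pos: "0 < t \<Longrightarrow> t < 1 \<Longrightarrow> beta_weight a b t > 0"
  by (simp add: beta_weight_def cpow_eq_powr)

lemma beta_weight_add:
  assumes "a \<ge> 0" "b \<ge> 0" "a' \<ge> 0" "b' \<ge> 0" "t \<in> {0..1}"
  shows "beta_weight (a + a') (b + b') t = beta_weight a b t * beta_weight a' b' t"
  using assms by (simp add: beta_weight_def cpow_add)

lemma beta_weight_of_nat:
  "t \<in> {0..1} \<Longrightarrow> beta_weight (real m) (real n) t = t ^ m * (1 - t) ^ n"
  by (simp add: beta_weight_def cpow_of_nat)

lemma beta_weight_add_1:
  assumes "a \<ge> 0" "b \<ge> 0" "t \<in> {0..1}"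
  shows "beta_weight (a + 1) (b + 1) t = beta_weight a b t * (t * (1 - t))"
    and "beta_weight (a + 1) b t = beta_weight a b t * t"
  using beta_weight_add[of a b 1 1 t] beta_weight_add[of a b 1 0 t] beta_weight_of_nat[of t 1 1]
    beta_weight_of_nat[of t 1 0] assms by simp_all

lemma beta_weight_reflect: "beta_weight a b (1 - t) = beta_weight b a t"
  by (simp add: beta_weight_def)

lemma beta_weight_derivative:
  assumes "0 < t" "t < 1"
  shows "(beta_weight a b has_real_derivative
            beta_weight a b t * (a / t - b / (1 - t))) (at t)"
proof -
  have "((\<lambda>t. t powr a * (1 - t) powr b) has_real_derivative
            beta_weight a b t * (a / t - b / (1 - t))) (at t)"
  proof -
    have "((\<lambda>t. t powr a) has_real_derivative t powr a * (a / t)) (at t)"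
      using has_real_derivative_powr[of t a] assms by (simp add: powr_diff mult_ac)
    moreover have "((\<lambda>t. (1 - t) powr b) has_real_derivative - ((1 - t) powr b * (b / (1 - t)))) (at t)"
    proof -
      have "((\<lambda>t. (1 - t) powr b) has_real_derivative b * (1 - t) powr (b - 1) * (- 1)) (at t)"
        by (rule DERIV_chain2[where f = "\<lambda>z. z powr b"])
           (use assms in \<open>auto intro!: has_real_derivative_powr derivative_eq_intros\<close>)
      thus ?thesis using assms by (simp add: powr_diff mult_ac)
    qed
    ultimately have "((\<lambda>t. t powr a * (1 - t) powr b) has_real_derivative
        t powr a * (a / t) * (1 - t) powr b + - ((1 - t) powr b * (b / (1 - t))) * t powr a) (at t)"
      by (rule DERIV_mult)
    moreover have "t powr a * (a / t) * (1 - t) powr b + - ((1 - t) powr b * (b / (1 - t))) * t powr a =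
        beta_weight a b t * (a / t - b / (1 - t))"
      using assms by (simp add: beta_weight_def cpow_eq_powr right_diff_distrib mult_ac)
    ultimately show ?thesis by simp
  qed
  moreover have ev: "\<forall>\<^sub>F s in nhds t. s powr a * (1 - s) powr b = beta_weight a b s"
    using eventually_nhds_in_open[of "{0<..<1}" t] assms
    by (auto elim!: eventually_mono simp: beta_weight_def cpow_eq_powr)
  ultimately show ?thesis
    using DERIV_cong_ev[OF refl ev refl] by simp
qed

lemma beta_weight_has_integral:
  assumes "a \<ge> 0" "b \<ge> 0"
  shows "(beta_weight a b has_integral Beta (a + 1) (b + 1)) {0..1}"
proof (rule has_integral_spike_finite[where S = "{0, 1}"])
  show "((\<lambda>t. t powr (a + 1 - 1) * (1 - t) powr (b + 1 - 1)) has_integral Beta (a + 1) (b + 1)) {0..1}"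
    using assms by (intro has_integral_Beta_real) auto
qed (auto simp: beta_weight_def cpow_eq_powr)

lemma Beta_pos: "a > 0 \<Longrightarrow> b > 0 \<Longrightarrow> Beta a b > (0::real)"
  by (simp add: Beta_def)

section \<open>Means with respect to Beta densities\<close>

text \<open>
  The parameters are the exponents of the density; those of the Beta function are larger by one.
\<close>

definition beta_mean :: "real \<Rightarrow> real \<Rightarrow> (real \<Rightarrow> real) \<Rightarrow> real" where
  "beta_mean a b f = integral {0..1} (\<lambda>t. f t * beta_weight a b t) / Beta (a + 1) (b + 1)"

lemma weighted_integrable:
  assumes "a \<ge> 0" "b \<ge> 0" "continuous_on {0..1} f"
  shows "(\<lambda>t. f t * beta_weight a b t) integrable_on {0..1}"
  using assms by (intro integrable_continuous_real continuous_intros)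

text \<open>
  An inequality on the open interval is enough, since both sides are continuous. This matters because
  \<open>tangent_error\<close> below says nothing about the end points.
\<close>

lemma beta_mean_mono:
  assumes "a \<ge> 0" "b \<ge> 0" "continuous_on {0..1} f" "continuous_on {0..1} g"
    and "\<And>t. t \<in> {0<..<1} \<Longrightarrow> f t \<le> g t"
  shows "beta_mean a b f \<le> beta_mean a b g"
proof -
  have "f t \<le> g t" if "t \<in> {0..1}" for t
  proof -
    have "closure {0<..<1::real} = {0..1}" by simp
    moreover have "continuous_on {0..1} (\<lambda>t. g t - f t)"
      using assms by (intro continuous_intros)
    ultimately have "0 \<le> g t - f t"
      using continuous_ge_on_closure[of "{0<..<1}" "\<lambda>t. g t - f t" t 0] that assms(5) by auto
    thus ?thesis by simp
  qed
  hence "integral {0..1} (\<lambda>t. f t * beta_weight a b t) \<le> integral {0..1} (\<lambda>t. g t * beta_weight a b t)"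
    using assms by (intro integral_le weighted_integrable mult_right_mono beta_weight_nonneg) auto
  thus ?thesis
    unfolding beta_mean_def using Beta_pos[of "a + 1" "b + 1"] assms by (intro divide_right_mono) auto
qed

lemma beta_mean_add:
  assumes "a \<ge> 0" "b \<ge> 0" "continuous_on {0..1} f" "continuous_on {0..1} g"
  shows "beta_mean a b (\<lambda>t. f t + g t) = beta_mean a b f + beta_mean a b g"
  unfolding beta_mean_def using assms
  by (simp add: distrib_right integral_add weighted_integrable add_divide_distrib)

lemma beta_mean_cmult: "beta_mean a b (\<lambda>t. c * f t) = c * beta_mean a b f"
  by (simp add: beta_mean_def mult.assoc)

lemma beta_mean_const:
  assumes "a \<ge> 0" "b \<ge> 0"
  shows "beta_mean a b (\<lambda>t. c) = c"
  using integral_unique[OF beta_weight_has_integral[OF assms]] Beta_pos[of "a + 1" "b + 1"] assms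
  by (simp add: beta_mean_def)

text \<open>
  A factor \<open>t\<close> is absorbed into the density by raising its first exponent. All polynomial means
  follow from this recursion.
\<close>

lemma beta_mean_times_id:
  assumes "a \<ge> 0" "b \<ge> 0"
  shows "beta_mean a b (\<lambda>t. f t * t) = (a + 1) / (a + b + 2) * beta_mean (a + 1) b f"
proof -
  define I where "I = integral {0..1} (\<lambda>t. f t * beta_weight (a + 1) b t)"
  define B\<^sub>1 where "B\<^sub>1 = Beta (a + 1) (b + 1)"
  define B\<^sub>2 where "B\<^sub>2 = Beta (a + 1 + 1) (b + 1)"
  have "integral {0..1} (\<lambda>t. f t * t * beta_weight a b t) = I"
    unfolding I_def using assms by (intro integral_cong) (simp add: beta_weight_add_1 mult_ac)
  hence lhs: "beta_mean a b (\<lambda>t. f t * t) = I / B\<^sub>1"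
    by (simp add: beta_mean_def B\<^sub>1_def)
  have "a + 1 \<notin> \<int>\<^sub>\<le>\<^sub>0"
    using assms by (auto elim!: nonpos_Ints_cases)
  hence "(a + 1 + (b + 1)) * B\<^sub>2 = (a + 1) * B\<^sub>1"
    unfolding B\<^sub>1_def B\<^sub>2_def by (rule Beta_plus1_left)
  hence "B\<^sub>2 = (a + 1) / (a + b + 2) * B\<^sub>1"
    using assms by (simp add: field_simps)
  moreover have "B\<^sub>1 > 0"
    using assms by (simp add: B\<^sub>1_def Beta_pos)
  moreover have "beta_mean (a + 1) b f = I / B\<^sub>2"
    by (simp add: beta_mean_def B\<^sub>2_def I_def)
  ultimately show ?thesis
    using lhs assms by simp
qed

lemma beta_mean_id:
  assumes "a \<ge> 0" "b \<ge> 0"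
  shows "beta_mean a b (\<lambda>t. t) = (a + 1) / (a + b + 2)"
  using beta_mean_times_id[OF assms, of "\<lambda>_. 1"] beta_mean_const[of "a + 1" b 1] assms by simp

lemma beta_variance:
  assumes ab: "a \<ge> 0" "b \<ge> 0" and m: "m = (a + 1) / (a + b + 2)"
  shows "beta_mean a b (\<lambda>t. (t - m)\<^sup>2) = m * (1 - m) / (a + b + 3)"
proof -
  have E1: "beta_mean a b (\<lambda>t. t) = m"
    using beta_mean_id[OF ab] m by simp
  have "beta_mean (a + 1) b (\<lambda>t. t) = (a + 1 + 1) / (a + 1 + b + 2)"
    by (rule beta_mean_id) (use ab in auto)
  also have "\<dots> = m + (1 - m) / (a + b + 3)"
    using ab by (simp add: m divide_simps) (simp add: algebra_simps)
  finally have E2: "beta_mean a b (\<lambda>t. t * t) = m * (m + (1 - m) / (a + b + 3))"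
    using beta_mean_times_id[OF ab, of "\<lambda>t. t"] m by simp
  have "beta_mean a b (\<lambda>t. (t - m)\<^sup>2) = beta_mean a b (\<lambda>t. t * t + ((- 2 * m) * t + m\<^sup>2))"
    by (rule arg_cong[where f = "beta_mean a b"]) (simp add: fun_eq_iff power2_eq_square algebra_simps)
  also have "\<dots> = beta_mean a b (\<lambda>t. t * t) + beta_mean a b (\<lambda>t. (- 2 * m) * t + m\<^sup>2)"
    by (rule beta_mean_add[OF ab]) (auto intro!: continuous_intros)
  also have "beta_mean a b (\<lambda>t. (- 2 * m) * t + m\<^sup>2) = beta_mean a b (\<lambda>t. (- 2 * m) * t) + beta_mean a b (\<lambda>t. m\<^sup>2)"
    by (rule beta_mean_add[OF ab]) (auto intro!: continuous_intros)
  finally show ?thesis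
    unfolding beta_mean_cmult beta_mean_const[OF ab] E1 E2
    by (simp add: algebra_simps power2_eq_square)
qed

text \<open>
  The Lagrange form of the remainder fails, because \<open>F''\<close> may grow like \<open>C / (s (1 - s))\<close> between
  \<open>m\<close> and \<open>t\<close>. Instead, compare \<open>F\<close> with the binary entropy \<open>\<phi>(s) = s ln s + (1 - s) ln (1 - s)\<close>, whose
  second derivative is exactly \<open>1 / (s (1 - s))\<close>: both \<open>C \<phi> + F\<close> and \<open>C \<phi> - F\<close> are convex, so \<open>F\<close> deviates
  from its tangent by at most \<open>C\<close> times the deviation of \<open>\<phi>\<close>. The latter is a relative entropy, and
  \<open>ln y \<le> y - 1\<close> bounds it by the corresponding chi-square distance.
\<close>

lemma tangent_error:
  fixes F F' F'' :: "real \<Rightarrow> real"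
  assumes F': "\<And>s. s \<in> {0<..<1} \<Longrightarrow> (F has_real_derivative F' s) (at s)"
    and F'': "\<And>s. s \<in> {0<..<1} \<Longrightarrow> (F' has_real_derivative F'' s) (at s)"
    and bound: "\<And>s. s \<in> {0<..<1} \<Longrightarrow> s * (1 - s) * \<bar>F'' s\<bar> \<le> C"
    and m: "m \<in> {0<..<1}" and t: "t \<in> {0<..<1}"
  shows "\<bar>F t - F m - F' m * (t - m)\<bar> \<le> C / (m * (1 - m)) * (t - m)\<^sup>2"
proof -
  define \<phi> where "\<phi> = (\<lambda>s::real. s * ln s + (1 - s) * ln (1 - s))"
  define \<phi>' where "\<phi>' = (\<lambda>s::real. ln s - ln (1 - s))"
  have \<phi>': "(\<phi> has_real_derivative \<phi>' s) (at s)" if "s \<in> {0<..<1}" for s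
    using that unfolding \<phi>_def \<phi>'_def by (auto intro!: derivative_eq_intros)
  have \<phi>'': "(\<phi>' has_real_derivative 1 / (s * (1 - s))) (at s)" if "s \<in> {0<..<1}" for s
    using that unfolding \<phi>'_def by (auto intro!: derivative_eq_intros simp: divide_simps)
  have C: "0 \<le> C"
    using bound[OF m] m by (intro order.trans[OF _ bound[OF m]]) auto
  have gap: "\<phi> t - \<phi> m - \<phi>' m * (t - m) \<le> (t - m)\<^sup>2 / (m * (1 - m))"
  proof -
    have "ln (t / m) \<le> t / m - 1" "ln ((1 - t) / (1 - m)) \<le> (1 - t) / (1 - m) - 1"
      using m t by (auto intro!: ln_le_minus_one)
    hence "t * ln (t / m) + (1 - t) * ln ((1 - t) / (1 - m))
        \<le> t * (t / m - 1) + (1 - t) * ((1 - t) / (1 - m) - 1)"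
      using t by (intro add_mono mult_left_mono) auto
    also have "\<dots> = (t - m)\<^sup>2 / (m * (1 - m))"
      using m by (simp add: divide_simps) (simp add: power2_eq_square algebra_simps)
    also have "t * ln (t / m) + (1 - t) * ln ((1 - t) / (1 - m)) = \<phi> t - \<phi> m - \<phi>' m * (t - m)"
      using m t by (simp add: \<phi>_def \<phi>'_def ln_div algebra_simps)
    finally show ?thesis .
  qed
  have one_sided: "- (\<sigma> * (F t - F m - F' m * (t - m))) \<le> C / (m * (1 - m)) * (t - m)\<^sup>2"
    if \<sigma>: "\<bar>\<sigma>\<bar> = 1" for \<sigma> :: real
  proof -
    have "(\<sigma> * F' m + C * \<phi>' m) * (t - m) \<le> (\<sigma> * F t + C * \<phi> t) - (\<sigma> * F m + C * \<phi> m)"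
    proof (rule f''_imp_f'[where C = "{0<..<1}" and f'' = "\<lambda>s. \<sigma> * F'' s + C * (1 / (s * (1 - s)))"])
      fix s :: real assume s: "s \<in> {0<..<1}"
      show "((\<lambda>s. \<sigma> * F s + C * \<phi> s) has_real_derivative \<sigma> * F' s + C * \<phi>' s) (at s)"
        using F'[OF s] \<phi>'[OF s] by (auto intro!: derivative_eq_intros)
      show "((\<lambda>s. \<sigma> * F' s + C * \<phi>' s) has_real_derivative \<sigma> * F'' s + C * (1 / (s * (1 - s)))) (at s)"
        using F''[OF s] \<phi>''[OF s] by (auto intro!: derivative_eq_intros)
      have "\<bar>F'' s\<bar> \<le> C / (s * (1 - s))"
        using bound[OF s] s by (simp add: field_simps)
      moreover have "\<bar>\<sigma> * F'' s\<bar> = \<bar>F'' s\<bar>" using \<sigma> by (simp add: abs_mult)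
      ultimately show "0 \<le> \<sigma> * F'' s + C * (1 / (s * (1 - s)))" by simp
    qed (use m t in auto)
    hence "- (\<sigma> * (F t - F m - F' m * (t - m))) \<le> C * (\<phi> t - \<phi> m - \<phi>' m * (t - m))"
      by (simp add: algebra_simps)
    also have "\<dots> \<le> C * ((t - m)\<^sup>2 / (m * (1 - m)))"
      by (intro mult_left_mono gap C)
    finally show ?thesis by simp
  qed
  show ?thesis using one_sided[of 1] one_sided[of "-1"] by (simp add: abs_le_iff)
qed

text \<open>
  Around the mean \<open>m\<close> the linear part of the tangent bound integrates to zero, and the variance
  \<open>m (1 - m) / (a + b + 3)\<close> cancels the factor \<open>1 / (m (1 - m))\<close> of the quadratic part. The bound is
  therefore uniform in the position of \<open>m\<close>.
\<close>

lemma beta_mean_error: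
  fixes F F' F'' :: "real \<Rightarrow> real"
  assumes ab: "a \<ge> 0" "b \<ge> 0" and cont: "continuous_on {0..1} F"
    and F': "\<And>s. s \<in> {0<..<1} \<Longrightarrow> (F has_real_derivative F' s) (at s)"
    and F'': "\<And>s. s \<in> {0<..<1} \<Longrightarrow> (F' has_real_derivative F'' s) (at s)"
    and bound: "\<And>s. s \<in> {0<..<1} \<Longrightarrow> s * (1 - s) * \<bar>F'' s\<bar> \<le> C"
  shows "\<bar>beta_mean a b F - F ((a + 1) / (a + b + 2))\<bar> \<le> C / (a + b + 3)"
proof -
  define m where "m = (a + 1) / (a + b + 2)"
  have m: "m \<in> {0<..<1}" using ab by (simp add: m_def)
  define K where "K = C / (m * (1 - m))"
  note err = tangent_error[OF F' F'' bound m, folded K_def]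
  have lin: "beta_mean a b (\<lambda>t. (F m - F' m * m) + (F' m * t + c * (t - m)\<^sup>2)) = F m + c * (m * (1 - m) / (a + b + 3))" for c
  proof -
    have "beta_mean a b (\<lambda>t. (F m - F' m * m) + (F' m * t + c * (t - m)\<^sup>2)) =
        beta_mean a b (\<lambda>t. F m - F' m * m) + beta_mean a b (\<lambda>t. F' m * t + c * (t - m)\<^sup>2)"
      by (rule beta_mean_add[OF ab]) (auto intro!: continuous_intros)
    also have "beta_mean a b (\<lambda>t. F' m * t + c * (t - m)\<^sup>2) =
        beta_mean a b (\<lambda>t. F' m * t) + beta_mean a b (\<lambda>t. c * (t - m)\<^sup>2)"
      by (rule beta_mean_add[OF ab]) (auto intro!: continuous_intros)
    finally show ?thesis
      unfolding beta_mean_cmult beta_mean_const[OF ab] beta_mean_id[OF ab] beta_variance[OF ab m_def]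
      by (simp add: m_def)
  qed
  have "beta_mean a b F \<le> beta_mean a b (\<lambda>t. (F m - F' m * m) + (F' m * t + K * (t - m)\<^sup>2))"
    using err by (intro beta_mean_mono ab cont continuous_intros) (auto simp: abs_le_iff algebra_simps)
  moreover have "beta_mean a b F \<ge> beta_mean a b (\<lambda>t. (F m - F' m * m) + (F' m * t + (- K) * (t - m)\<^sup>2))"
    using err by (intro beta_mean_mono ab cont continuous_intros) (auto simp: abs_le_iff algebra_simps)
  moreover have "K * (m * (1 - m) / (a + b + 3)) = C / (a + b + 3)"
    using m by (simp add: K_def)
  ultimately show ?thesis
    unfolding lin m_def[symmetric] using lin[of K] lin[of "- K"] by linarith
qed

section \<open>Jacobi polynomials on the unit interval\<close>

definition jacobi_coeff :: "real \<Rightarrow> nat \<Rightarrow> nat \<Rightarrow> real" where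
  "jacobi_coeff \<alpha> k j =
     pochhammer (- real k) j * pochhammer (real k + 2 * \<alpha> + 1) j / (pochhammer (\<alpha> + 1) j * fact j)"

text \<open>
  The hypergeometric polynomial in \<open>t = (1 - x) / 2\<close>, normalized by the value \<open>1\<close> at \<open>t = 0\<close>. Fourier
  expansions do not depend on the normalization, and with this one all sup-norm bounds are uniform in \<open>k\<close>.
\<close>

definition jacobi01 :: "real \<Rightarrow> nat \<Rightarrow> real poly" where
  "jacobi01 \<alpha> k = (\<Sum>j\<le>k. monom (jacobi_coeff \<alpha> k j) j)"

definition jacobi_eigenvalue :: "real \<Rightarrow> nat \<Rightarrow> real" where
  "jacobi_eigenvalue \<alpha> k = real k * (real k + 2 * \<alpha> + 1)"

definition jacobi01_inner :: "real \<Rightarrow> (real \<Rightarrow> real) \<Rightarrow> (real \<Rightarrow> real) \<Rightarrow> real" where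
  "jacobi01_inner \<alpha> f g = integral {0..1} (\<lambda>t. f t * g t * beta_weight \<alpha> \<alpha> t)"

lemma eigenvalue_nonneg: "\<alpha> \<ge> 0 \<Longrightarrow> jacobi_eigenvalue \<alpha> k \<ge> 0"
  by (simp add: jacobi_eigenvalue_def)

lemma eigenvalue_pos: "\<alpha> \<ge> 0 \<Longrightarrow> k > 0 \<Longrightarrow> jacobi_eigenvalue \<alpha> k > 0"
  by (simp add: jacobi_eigenvalue_def)

lemma coeff_jacobi01: "coeff (jacobi01 \<alpha> k) j = jacobi_coeff \<alpha> k j"
proof (cases "j \<le> k")
  case False
  hence "pochhammer (- real k) j = 0"
    by (simp add: pochhammer_of_nat_eq_0_iff)
  thus ?thesis using False by (simp add: jacobi01_def coeff_sum jacobi_coeff_def)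
qed (simp add: jacobi01_def coeff_sum)

lemma jacobi_coeff_top:
  assumes "\<alpha> \<ge> 0"
  shows "jacobi_coeff \<alpha> k k \<noteq> 0"
proof -
  have "pochhammer (real k + 2 * \<alpha> + 1) k > 0" "pochhammer (\<alpha> + 1) k > 0"
    using assms by (auto intro!: pochhammer_pos)
  moreover have "pochhammer (- real k) k \<noteq> 0"
    by (simp add: pochhammer_of_nat_eq_0_iff)
  ultimately show ?thesis by (simp add: jacobi_coeff_def)
qed

lemma degree_jacobi01_le: "degree (jacobi01 \<alpha> k) \<le> k"
  by (rule degree_le)
     (simp add: coeff_jacobi01 jacobi_coeff_def pochhammer_of_nat_eq_0_iff)

lemma poly_jacobi01_0: "poly (jacobi01 \<alpha> k) 0 = 1"
  by (simp add: poly_0_coeff_0 coeff_jacobi01 jacobi_coeff_def)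

lemma jacobi01_0: "jacobi01 \<alpha> 0 = 1"
  by (simp add: jacobi01_def jacobi_coeff_def)

text \<open>
  Differentiation lowers the degree by one and raises \<open>\<alpha>\<close> by one. Orthogonality, the norms and the
  derivative bounds are all obtained along this ladder, by induction on \<open>k\<close> for all \<open>\<alpha>\<close> at once.
\<close>

lemma pderiv_jacobi01_Suc:
  assumes "\<alpha> \<ge> 0"
  shows "pderiv (jacobi01 \<alpha> (Suc k)) =
    smult (- jacobi_eigenvalue \<alpha> (Suc k) / (\<alpha> + 1)) (jacobi01 (\<alpha> + 1) k)"
proof (rule poly_eqI)
  fix j
  have "pochhammer (- real (Suc k)) (Suc j) = - real (Suc k) * pochhammer (- real k) j"
    by (simp add: pochhammer_rec)
  moreover have "pochhammer (real (Suc k) + 2 * \<alpha> + 1) (Suc j) =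
      (real (Suc k) + 2 * \<alpha> + 1) * pochhammer (real k + 2 * (\<alpha> + 1) + 1) j"
    by (simp add: pochhammer_rec algebra_simps)
  moreover have "pochhammer (\<alpha> + 1) (Suc j) = (\<alpha> + 1) * pochhammer (\<alpha> + 1 + 1) j"
    by (simp add: pochhammer_rec)
  moreover have "fact (Suc j) = real (Suc j) * fact j" by simp
  moreover have "pochhammer (\<alpha> + 1 + 1) j > 0" using assms by (intro pochhammer_pos) auto
  ultimately show "coeff (pderiv (jacobi01 \<alpha> (Suc k))) j =
      coeff (smult (- jacobi_eigenvalue \<alpha> (Suc k) / (\<alpha> + 1)) (jacobi01 (\<alpha> + 1) k)) j"
    using assms
    unfolding coeff_pderiv coeff_smult coeff_jacobi01 jacobi_coeff_def jacobi_eigenvalue_def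
    by (simp add: divide_simps del: of_nat_Suc fact_Suc)
qed

text \<open>
  On coefficients this is the two-term recursion of a hypergeometric series.
\<close>

lemma jacobi_ode:
  assumes "\<alpha> \<ge> 0"
  shows "t * (1 - t) * poly (pderiv (pderiv (jacobi01 \<alpha> k))) t
      + (\<alpha> + 1) * (1 - 2 * t) * poly (pderiv (jacobi01 \<alpha> k)) t
      + jacobi_eigenvalue \<alpha> k * poly (jacobi01 \<alpha> k) t = 0"
proof -
  define p where "p = jacobi01 \<alpha> k"
  have rec: "coeff p (Suc j) * (real j + 1) * (real j + \<alpha> + 1) =
      coeff p j * ((real j - real k) * (real j + real k + 2 * \<alpha> + 1))" for j
  proof -
    have "pochhammer (\<alpha> + 1) j > 0" using assms by (intro pochhammer_pos) auto
    moreover have "pochhammer (\<alpha> + 1) (Suc j) = pochhammer (\<alpha> + 1) j * (real j + \<alpha> + 1)"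
      by (simp add: pochhammer_Suc add_ac)
    moreover have "pochhammer (- real k) (Suc j) = pochhammer (- real k) j * (real j - real k)"
      by (simp add: pochhammer_Suc)
    moreover have "pochhammer (real k + 2 * \<alpha> + 1) (Suc j) =
        pochhammer (real k + 2 * \<alpha> + 1) j * (real j + real k + 2 * \<alpha> + 1)"
      by (simp add: pochhammer_Suc add_ac)
    moreover have "fact (Suc j) = (real j + 1) * fact j" by simp
    moreover have "real j + \<alpha> + 1 > 0" using assms by simp
    ultimately show ?thesis
      unfolding p_def coeff_jacobi01 jacobi_coeff_def
      by (simp add: divide_simps del: fact_Suc)
  qed
  have "[:0, 1, -1:] * pderiv (pderiv p) + smult (\<alpha> + 1) ([:1, -2:] * pderiv p)
      + smult (jacobi_eigenvalue \<alpha> k) p = 0" (is "?q = 0")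
  proof (rule poly_eqI)
    fix j
    show "coeff ?q j = coeff 0 j"
    proof (cases j)
      case 0
      thus ?thesis using rec[of 0]
        by (simp add: coeff_pderiv coeff_pCons jacobi_eigenvalue_def algebra_simps)
    next
      case (Suc i)
      thus ?thesis using rec[of j]
        by (cases i) (simp_all add: coeff_pderiv coeff_pCons jacobi_eigenvalue_def algebra_simps)
    qed
  qed
  hence "poly ?q t = 0" by simp
  thus ?thesis by (simp add: p_def algebra_simps)
qed

lemma poly_weighted_integrable:
  "\<alpha> \<ge> 0 \<Longrightarrow> (\<lambda>t. poly p t * beta_weight \<alpha> \<alpha> t) integrable_on {0..1}"
  by (intro weighted_integrable continuous_intros) auto

text \<open>
  In self-adjoint form the differential equation reads \<open>(W p')' = - \<lambda> w p\<close> with \<open>W = t (1 - t) w\<close>, the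
  weight for \<open>\<alpha> + 1\<close>. Since \<open>W\<close> vanishes at both ends, integration by parts has no boundary terms.
\<close>

lemma jacobi01_inner_parts:
  assumes "\<alpha> \<ge> 0"
  shows "jacobi_eigenvalue \<alpha> k * jacobi01_inner \<alpha> (poly (jacobi01 \<alpha> k)) (poly g) =
    jacobi01_inner (\<alpha> + 1) (poly (pderiv (jacobi01 \<alpha> k))) (poly (pderiv g))"
proof -
  define p where "p = jacobi01 \<alpha> k"
  define ev where "ev = jacobi_eigenvalue \<alpha> k"
  define W where "W = beta_weight (\<alpha> + 1) (\<alpha> + 1)"
  define w where "w = beta_weight \<alpha> \<alpha>"
  define f' where "f' = (\<lambda>t. w t * (t * (1 - t) * poly (pderiv p) t * poly (pderiv g) t - ev * poly p t * poly g t))"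
  have "(f' has_integral (W 1 * poly (pderiv p) 1 * poly g 1 - W 0 * poly (pderiv p) 0 * poly g 0)) {0..1}"
  proof (rule fundamental_theorem_of_calculus_interior)
    show "continuous_on {0..1} (\<lambda>t. W t * poly (pderiv p) t * poly g t)"
      unfolding W_def using assms by (intro continuous_intros) auto
    fix t :: real assume t: "t \<in> {0<..<1}"
    have Wt: "W t = w t * (t * (1 - t))"
      using beta_weight_add_1(1)[of \<alpha> \<alpha> t] assms t by (simp add: W_def w_def)
    have "W t * ((\<alpha> + 1) / t - (\<alpha> + 1) / (1 - t)) = w t * ((\<alpha> + 1) * (1 - 2 * t))"
      using t by (simp add: Wt field_simps)
    hence W': "(W has_real_derivative w t * ((\<alpha> + 1) * (1 - 2 * t))) (at t)"
      using beta_weight_derivative[of t "\<alpha> + 1" "\<alpha> + 1"] t by (simp add: W_def)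
    have "((\<lambda>t. W t * poly (pderiv p) t * poly g t) has_real_derivative
        ((w t * ((\<alpha> + 1) * (1 - 2 * t))) * poly (pderiv p) t + poly (pderiv (pderiv p)) t * W t) * poly g t
        + poly (pderiv g) t * (W t * poly (pderiv p) t)) (at t)"
      by (intro DERIV_mult W' poly_DERIV)
    also have "((w t * ((\<alpha> + 1) * (1 - 2 * t))) * poly (pderiv p) t + poly (pderiv (pderiv p)) t * W t) * poly g t
        + poly (pderiv g) t * (W t * poly (pderiv p) t) =
        w t * poly g t * (t * (1 - t) * poly (pderiv (pderiv p)) t + (\<alpha> + 1) * (1 - 2 * t) * poly (pderiv p) t)
        + w t * (t * (1 - t) * poly (pderiv p) t * poly (pderiv g) t)"
      by (simp only: Wt) algebra
    also have "t * (1 - t) * poly (pderiv (pderiv p)) t + (\<alpha> + 1) * (1 - 2 * t) * poly (pderiv p) t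
        = - ev * poly p t"
      using jacobi_ode[OF assms, of t k] by (simp add: p_def ev_def)
    also have "w t * poly g t * (- ev * poly p t) + w t * (t * (1 - t) * poly (pderiv p) t * poly (pderiv g) t) = f' t"
      unfolding f'_def by algebra
    finally show "((\<lambda>t. W t * poly (pderiv p) t * poly g t) has_vector_derivative f' t) (at t)"
      by (simp add: has_real_derivative_iff_has_vector_derivative)
  qed simp
  moreover have "W 1 = 0" "W 0 = 0"
    using assms by (simp_all add: W_def beta_weight_def cpow_def)
  ultimately have int0: "integral {0..1} f' = 0" by (simp add: integral_unique)
  have "integral {0..1} f' = integral {0..1} (\<lambda>t. poly (pderiv p * pderiv g) t * W t
      - ev * (poly (p * g) t * w t))"
  proof (rule integral_cong)
    fix t :: real assume "t \<in> {0..1}"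
    hence Wt: "W t = w t * (t * (1 - t))"
      unfolding W_def w_def by (rule beta_weight_add_1(1)[OF assms assms])
    show "f' t = poly (pderiv p * pderiv g) t * W t - ev * (poly (p * g) t * w t)"
      unfolding f'_def Wt poly_mult by algebra
  qed
  also have "\<dots> = integral {0..1} (\<lambda>t. poly (pderiv p * pderiv g) t * W t)
      - integral {0..1} (\<lambda>t. ev * (poly (p * g) t * w t))"
    unfolding W_def w_def using assms
    by (intro integral_diff poly_weighted_integrable integrable_on_mult_right) auto
  also have "\<dots> = jacobi01_inner (\<alpha> + 1) (poly (pderiv p)) (poly (pderiv g)) - ev * jacobi01_inner \<alpha> (poly p) (poly g)"
    by (simp add: jacobi01_inner_def W_def w_def)
  finally show ?thesis using int0 by (simp add: p_def ev_def)
qed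

lemma jacobi01_inner_poly_linear:
  assumes "\<alpha> \<ge> 0"
  shows "jacobi01_inner \<alpha> (poly (smult c p)) f = c * jacobi01_inner \<alpha> (poly p) f"
    and "jacobi01_inner \<alpha> f (poly (smult c p)) = c * jacobi01_inner \<alpha> f (poly p)"
    and "jacobi01_inner \<alpha> (poly (p - q)) (poly g) = jacobi01_inner \<alpha> (poly p) (poly g) - jacobi01_inner \<alpha> (poly q) (poly g)"
proof -
  have "jacobi01_inner \<alpha> (poly (smult c p)) f = integral {0..1} (\<lambda>t. c * (poly p t * f t * beta_weight \<alpha> \<alpha> t))"
    by (simp add: jacobi01_inner_def mult_ac)
  thus "jacobi01_inner \<alpha> (poly (smult c p)) f = c * jacobi01_inner \<alpha> (poly p) f"
    by (simp add: jacobi01_inner_def)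
  have "jacobi01_inner \<alpha> f (poly (smult c p)) = integral {0..1} (\<lambda>t. c * (f t * poly p t * beta_weight \<alpha> \<alpha> t))"
    by (simp add: jacobi01_inner_def mult_ac)
  thus "jacobi01_inner \<alpha> f (poly (smult c p)) = c * jacobi01_inner \<alpha> f (poly p)"
    by (simp add: jacobi01_inner_def)
  have "jacobi01_inner \<alpha> (poly (p - q)) (poly g) =
      integral {0..1} (\<lambda>t. poly (p * g) t * beta_weight \<alpha> \<alpha> t - poly (q * g) t * beta_weight \<alpha> \<alpha> t)"
    by (simp add: jacobi01_inner_def algebra_simps)
  also have "\<dots> = integral {0..1} (\<lambda>t. poly (p * g) t * beta_weight \<alpha> \<alpha> t)
      - integral {0..1} (\<lambda>t. poly (q * g) t * beta_weight \<alpha> \<alpha> t)"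
    by (intro integral_diff poly_weighted_integrable assms)
  finally show "jacobi01_inner \<alpha> (poly (p - q)) (poly g) = jacobi01_inner \<alpha> (poly p) (poly g) - jacobi01_inner \<alpha> (poly q) (poly g)"
    by (simp add: jacobi01_inner_def)
qed

text \<open>
  Integration by parts replaces both polynomials by their derivatives, so both degrees drop by one until
  nothing is left of \<open>g\<close>.
\<close>

lemma jacobi01_orthogonal:
  assumes "\<alpha> \<ge> 0" "degree g < k"
  shows "jacobi01_inner \<alpha> (poly (jacobi01 \<alpha> k)) (poly g) = 0"
  using assms
proof (induction k arbitrary: \<alpha> g)
  case (Suc k)
  have "jacobi01_inner (\<alpha> + 1) (poly (jacobi01 (\<alpha> + 1) k)) (poly (pderiv g)) = 0"
  proof (cases "pderiv g = 0")
    case False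
    hence "degree (pderiv g) < k"
      using Suc.prems by (cases "degree g") (auto simp: degree_pderiv pderiv_eq_0_iff)
    thus ?thesis using Suc.IH[of "\<alpha> + 1"] Suc.prems by simp
  qed (simp add: jacobi01_inner_def)
  hence "jacobi_eigenvalue \<alpha> (Suc k) * jacobi01_inner \<alpha> (poly (jacobi01 \<alpha> (Suc k))) (poly g) = 0"
    using Suc.prems by (simp add: jacobi01_inner_parts pderiv_jacobi01_Suc jacobi01_inner_poly_linear del: poly_smult smult_minus_left)
  thus ?case using eigenvalue_pos[of \<alpha> "Suc k"] Suc.prems by simp
qed simp

text \<open>
  Integration by parts with \<open>g = p\<^sub>k\<close> reduces the norm for \<open>(\<alpha>, k)\<close> to the one for \<open>(\<alpha> + 1, k - 1)\<close>; the
  ladder ends in a Beta integral.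
\<close>

lemma jacobi01_norm:
  assumes "\<alpha> \<ge> 0"
  shows "jacobi01_inner \<alpha> (poly (jacobi01 \<alpha> k)) (poly (jacobi01 \<alpha> k)) =
    (Gamma (\<alpha> + 1))\<^sup>2 * fact k / ((2 * real k + 2 * \<alpha> + 1) * Gamma (real k + 2 * \<alpha> + 1))"
  using assms
proof (induction k arbitrary: \<alpha>)
  case 0
  have "Gamma (2 * \<alpha> + 1 + 1) = (2 * \<alpha> + 1) * Gamma (2 * \<alpha> + 1)"
    using 0 by (intro Gamma_plus1) (auto elim!: nonpos_Ints_cases)
  moreover have "jacobi01_inner \<alpha> (poly (jacobi01 \<alpha> 0)) (poly (jacobi01 \<alpha> 0)) = Beta (\<alpha> + 1) (\<alpha> + 1)"
    using integral_unique[OF beta_weight_has_integral[OF 0 0]] by (simp add: jacobi01_inner_def jacobi01_0)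
  ultimately show ?case by (simp add: Beta_def power2_eq_square add_ac)
next
  case (Suc k)
  define ev where "ev = jacobi_eigenvalue \<alpha> (Suc k)"
  define K where "K = real (Suc k)"
  define G where "G = Gamma (K + 2 * \<alpha> + 1)"
  have ev: "ev > 0" using eigenvalue_pos Suc.prems by (simp add: ev_def)
  have ev_eq: "ev = K * (K + 2 * \<alpha> + 1)" by (simp add: ev_def jacobi_eigenvalue_def K_def)
  have K: "K > 0" by (simp add: K_def)
  have "G > 0" unfolding G_def using Suc.prems K by (intro Gamma_real_pos) auto
  have G1: "Gamma (\<alpha> + 1 + 1) = (\<alpha> + 1) * Gamma (\<alpha> + 1)"
    using Suc.prems by (intro Gamma_plus1) (auto elim!: nonpos_Ints_cases)
  have "Gamma (K + 2 * \<alpha> + 1 + 1) = (K + 2 * \<alpha> + 1) * G"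
    unfolding G_def using Suc.prems K by (intro Gamma_plus1) (auto elim!: nonpos_Ints_cases)
  moreover have "K + 2 * \<alpha> + 1 + 1 = real k + 2 * (\<alpha> + 1) + 1"
    "2 * real k + 2 * (\<alpha> + 1) + 1 = 2 * K + 2 * \<alpha> + 1"
    by (simp_all add: K_def)
  ultimately have IH: "jacobi01_inner (\<alpha> + 1) (poly (jacobi01 (\<alpha> + 1) k)) (poly (jacobi01 (\<alpha> + 1) k)) =
      ((\<alpha> + 1) * Gamma (\<alpha> + 1))\<^sup>2 * fact k / ((2 * K + 2 * \<alpha> + 1) * ((K + 2 * \<alpha> + 1) * G))"
    using Suc.IH[of "\<alpha> + 1"] Suc.prems G1 by simp
  have "ev * jacobi01_inner \<alpha> (poly (jacobi01 \<alpha> (Suc k))) (poly (jacobi01 \<alpha> (Suc k))) =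
      (ev / (\<alpha> + 1))\<^sup>2 * jacobi01_inner (\<alpha> + 1) (poly (jacobi01 (\<alpha> + 1) k)) (poly (jacobi01 (\<alpha> + 1) k))"
    using Suc.prems unfolding ev_def
    by (simp add: jacobi01_inner_parts pderiv_jacobi01_Suc jacobi01_inner_poly_linear power2_eq_square del: poly_smult smult_minus_left)
  hence "jacobi01_inner \<alpha> (poly (jacobi01 \<alpha> (Suc k))) (poly (jacobi01 \<alpha> (Suc k))) =
      ev / (\<alpha> + 1)\<^sup>2 * (((\<alpha> + 1) * Gamma (\<alpha> + 1))\<^sup>2 * fact k / ((2 * K + 2 * \<alpha> + 1) * ((K + 2 * \<alpha> + 1) * G)))"
    (is "?h = ?rhs")
  proof -
    assume "ev * ?h = (ev / (\<alpha> + 1))\<^sup>2 * jacobi01_inner (\<alpha> + 1) (poly (jacobi01 (\<alpha> + 1) k)) (poly (jacobi01 (\<alpha> + 1) k))"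
    also have "\<dots> = ev * ?rhs"
      unfolding IH by (simp add: power2_eq_square)
    finally show ?thesis using ev by (metis less_irrefl mult_left_cancel)
  qed
  also have "\<dots> = (Gamma (\<alpha> + 1))\<^sup>2 * (K * fact k) / ((2 * K + 2 * \<alpha> + 1) * G)"
    unfolding ev_eq using Suc.prems K \<open>G > 0\<close> by (simp add: power2_eq_square divide_simps)
  also have "K * fact k = fact (Suc k)" by (simp add: K_def)
  finally show ?case by (simp add: K_def G_def)
qed

lemma jacobi01_norm_pos:
  assumes "\<alpha> \<ge> 0"
  shows "jacobi01_inner \<alpha> (poly (jacobi01 \<alpha> k)) (poly (jacobi01 \<alpha> k)) > 0"
proof -
  have "Gamma (\<alpha> + 1) > 0" "Gamma (real k + 2 * \<alpha> + 1) > 0"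
    using assms by (auto intro!: Gamma_real_pos simp del: Gamma_eq_zero_iff)
  thus ?thesis unfolding jacobi01_norm[OF assms] using assms
    by (intro divide_pos_pos mult_pos_pos zero_less_power) auto
qed

text \<open>
  The Pochhammer symbol divided by \<open>k!\<close> is the product of the factors \<open>1 + s / j\<close>, and for \<open>j \<ge> 2\<close> such
  a factor is at most \<open>exp (s / j) \<le> (j / (j - 1)) powr s\<close>; these bounds telescope.
\<close>

lemma pochhammer_growth:
  assumes "s \<ge> 0" "k > 0"
  shows "pochhammer (s + 1) k \<le> (1 + s) * fact k * real k powr s"
  using assms(2)
proof (induction k rule: nat_induct_non_zero)
  case 1
  thus ?case by simp
next
  case (Suc k)
  have "1 / (real k + 1) \<le> ln ((real k + 1) / real k)"
    using ln_le_minus_one[of "real k / (real k + 1)"] Suc.hyps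
    by (simp add: ln_div field_simps)
  hence "s / (real k + 1) \<le> s * ln ((real k + 1) / real k)"
    using mult_left_mono[OF _ assms(1)] by fastforce
  hence "1 + s / (real k + 1) \<le> exp (s * ln ((real k + 1) / real k))"
    by (intro order.trans[OF exp_ge_add_one_self]) simp
  also have "\<dots> = (real k + 1) powr s / real k powr s"
    using Suc.hyps by (simp add: powr_def ln_div exp_diff right_diff_distrib)
  finally have "(real k + 1 + s) * real k powr s \<le> (real k + 1) * (real k + 1) powr s"
    using Suc.hyps by (simp add: field_simps)
  hence "pochhammer (s + 1) k * (real k + 1 + s) * real k powr s \<le>
      pochhammer (s + 1) k * (real k + 1) * (real k + 1) powr s"
    using assms(1) by (simp add: mult.assoc mult_left_mono pochhammer_nonneg)
  also have "\<dots> \<le> ((1 + s) * fact k * real k powr s) * (real k + 1) * (real k + 1) powr s"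
    using Suc.IH by (intro mult_right_mono) auto
  finally have "(pochhammer (s + 1) k * (real k + 1 + s)) * real k powr s \<le>
      ((1 + s) * ((real k + 1) * fact k) * (real k + 1) powr s) * real k powr s"
    by (simp only: mult_ac)
  hence "pochhammer (s + 1) k * (real k + 1 + s) \<le> (1 + s) * ((real k + 1) * fact k) * (real k + 1) powr s"
    using Suc.hyps by (simp only: mult_le_cancel_right) (auto simp: not_less)
  thus ?case by (simp add: pochhammer_Suc add_ac)
qed

text \<open>
  The power \<open>2\<alpha> + 1\<close> is the true order of growth. A softer bound on the norm, read off from the size
  of \<open>p\<^sub>k\<close> near \<open>0\<close> alone, would lose one power of \<open>k\<close>, too much for the final rate when \<open>\<alpha> > 0\<close>.
\<close>

lemma jacobi01_norm_lower_bound: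
  assumes "\<alpha> \<ge> 0"
  obtains C where "C > 0"
    "\<And>k. 1 / jacobi01_inner \<alpha> (poly (jacobi01 \<alpha> k)) (poly (jacobi01 \<alpha> k)) \<le> C * (real k + 1) powr (2 * \<alpha> + 1)"
proof
  define g where "g = (Gamma (\<alpha> + 1))\<^sup>2"
  have g: "g > 0" unfolding g_def using assms by (intro zero_less_power Gamma_real_pos) auto
  have G: "Gamma (2 * \<alpha> + 1) > 0" using assms by (intro Gamma_real_pos) auto
  show "(2 * \<alpha> + 2) * Gamma (2 * \<alpha> + 1) * (1 + 2 * \<alpha>) / g > 0"
    using assms g G by (intro divide_pos_pos mult_pos_pos) auto
  fix k
  have "2 * \<alpha> + 1 \<notin> \<int>\<^sub>\<le>\<^sub>0" using assms by (auto elim!: nonpos_Ints_cases)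
  hence poch: "Gamma (real k + 2 * \<alpha> + 1) = pochhammer (2 * \<alpha> + 1) k * Gamma (2 * \<alpha> + 1)"
    using pochhammer_Gamma[of "2 * \<alpha> + 1" k] G by (simp add: add_ac)
  have growth: "pochhammer (2 * \<alpha> + 1) k \<le> (1 + 2 * \<alpha>) * fact k * (real k + 1) powr (2 * \<alpha>)"
  proof (cases "k = 0")
    case False
    have "pochhammer (2 * \<alpha> + 1) k \<le> (1 + 2 * \<alpha>) * fact k * real k powr (2 * \<alpha>)"
      using pochhammer_growth[of "2 * \<alpha>" k] False assms by simp
    also have "\<dots> \<le> (1 + 2 * \<alpha>) * fact k * (real k + 1) powr (2 * \<alpha>)"
      using assms by (intro mult_left_mono powr_mono2) auto
    finally show ?thesis .
  qed (use assms in auto)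
  have "1 / jacobi01_inner \<alpha> (poly (jacobi01 \<alpha> k)) (poly (jacobi01 \<alpha> k)) =
      (2 * real k + 2 * \<alpha> + 1) * (Gamma (2 * \<alpha> + 1) / (g * fact k)) * pochhammer (2 * \<alpha> + 1) k"
    unfolding jacobi01_norm[OF assms] poch g_def[symmetric] by (simp add: mult_ac)
  also have "\<dots> \<le> ((2 * \<alpha> + 2) * (real k + 1)) * (Gamma (2 * \<alpha> + 1) / (g * fact k)) *
      ((1 + 2 * \<alpha>) * fact k * (real k + 1) powr (2 * \<alpha>))"
  proof (intro mult_mono growth mult_nonneg_nonneg)
    have "0 \<le> 2 * \<alpha> * real k" using assms by simp
    thus "2 * real k + 2 * \<alpha> + 1 \<le> (2 * \<alpha> + 2) * (real k + 1)" by (simp add: algebra_simps)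
  qed (use assms G g in \<open>auto intro!: pochhammer_nonneg\<close>)
  also have "\<dots> = (2 * \<alpha> + 2) * Gamma (2 * \<alpha> + 1) * (1 + 2 * \<alpha>) / g * ((real k + 1) powr (2 * \<alpha>) * (real k + 1))"
    using g by (simp add: field_simps)
  also have "(real k + 1) powr (2 * \<alpha>) * (real k + 1) = (real k + 1) powr (2 * \<alpha> + 1)"
    by (simp add: powr_add)
  finally show "1 / jacobi01_inner \<alpha> (poly (jacobi01 \<alpha> k)) (poly (jacobi01 \<alpha> k)) \<le>
      (2 * \<alpha> + 2) * Gamma (2 * \<alpha> + 1) * (1 + 2 * \<alpha>) / g * (real k + 1) powr (2 * \<alpha> + 1)" .
qed

text \<open>
  Subtract the multiple of \<open>p\<^sub>k\<close> that removes the leading coefficient: the rest has lower degree, so it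
  is orthogonal to itself.
\<close>

lemma jacobi01_unique:
  assumes "\<alpha> \<ge> 0" "degree r \<le> k"
    and orth: "\<And>g. degree g < k \<Longrightarrow> jacobi01_inner \<alpha> (poly r) (poly g) = 0"
  obtains c where "r = smult c (jacobi01 \<alpha> k)"
proof
  define c where "c = coeff r k / jacobi_coeff \<alpha> k k"
  define s where "s = r - smult c (jacobi01 \<alpha> k)"
  have "coeff s k = 0"
    using jacobi_coeff_top[OF assms(1)] by (simp add: s_def coeff_jacobi01 c_def)
  moreover have "degree s \<le> k"
    unfolding s_def using assms(2) degree_jacobi01_le[of \<alpha> k]
    by (intro degree_diff_le) (auto intro: order.trans[OF degree_smult_le])
  ultimately have s: "s = 0 \<or> degree s < k"
    by (metis le_neq_implies_less leading_coeff_0_iff)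
  hence "jacobi01_inner \<alpha> (poly s) (poly s) = 0"
  proof
    assume "degree s < k"
    thus ?thesis using orth[of s] jacobi01_orthogonal[OF assms(1), of s k]
      by (subst (1) s_def) (simp add: jacobi01_inner_poly_linear assms(1) del: poly_smult poly_diff)
  qed (simp add: jacobi01_inner_def)
  moreover have "continuous_on {0..1} (\<lambda>t. poly s t * poly s t * beta_weight \<alpha> \<alpha> t)"
    using assms(1) by (intro continuous_intros) auto
  moreover have "poly s t * poly s t * beta_weight \<alpha> \<alpha> t \<ge> 0" if "t \<in> {0..1}" for t
    using beta_weight_nonneg[OF that] by simp
  ultimately have "\<forall>t\<in>{0..1}. poly s t * poly s t * beta_weight \<alpha> \<alpha> t = 0"
    unfolding jacobi01_inner_def by (subst (asm) integral_eq_0_iff) auto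
  hence "poly s t = 0" if "t \<in> {0<..<1}" for t
    using that beta_weight_pos[of t \<alpha> \<alpha>] by auto
  hence "{0<..<1} \<subseteq> {t. poly s t = 0}" by auto
  hence "s = 0"
    using poly_roots_finite[of s] infinite_super[of "{0<..<1::real}"] by auto
  thus "r = smult c (jacobi01 \<alpha> k)" by (simp add: s_def)
qed

section \<open>Symmetry and pointwise bounds for Jacobi polynomials\<close>

lemma integral_reflect01:
  fixes f :: "real \<Rightarrow> real"
  assumes "continuous_on {0..1} f"
  shows "integral {0..1} (\<lambda>t. f (1 - t)) = integral {0..1} f"
proof -
  have "(f has_integral integral {0..1} f) (cbox 0 1)"
    using assms by (auto intro!: integrable_integral integrable_continuous_real)
  from has_integral_affinity[OF this, of "-1" 1]
  have "((\<lambda>t. f (1 - t)) has_integral integral {0..1} f) ((\<lambda>t. 1 - t) ` {0..1})"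
    by (simp add: add.commute)
  moreover have "(\<lambda>t. 1 - t) ` {0..1} = {0..1::real}"
    by simp
  ultimately show ?thesis by (simp add: integral_unique)
qed

text \<open>
  The weight is symmetric, so the reflected polynomial satisfies the same orthogonality relations and
  is a multiple of \<open>p\<^sub>k\<close>; equality of the norms leaves only the factors \<open>1\<close> and \<open>-1\<close>.
\<close>

lemma jacobi01_reflect:
  assumes "\<alpha> \<ge> 0"
  obtains c where "\<bar>c\<bar> = 1" "\<And>t. poly (jacobi01 \<alpha> k) (1 - t) = c * poly (jacobi01 \<alpha> k) t"
proof -
  define p where "p = jacobi01 \<alpha> k"
  define r where "r = pcompose p [:1, -1:]"
  have r: "poly r t = poly p (1 - t)" for t by (simp add: r_def poly_pcompose)
  have refl: "jacobi01_inner \<alpha> (\<lambda>t. f (1 - t)) (\<lambda>t. g (1 - t)) = jacobi01_inner \<alpha> f g"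
    if "continuous_on {0..1} f" "continuous_on {0..1} g" for f g
  proof -
    have "continuous_on {0..1} (\<lambda>t. f t * g t * beta_weight \<alpha> \<alpha> t)"
      using that assms by (intro continuous_intros)
    from integral_reflect01[OF this] show ?thesis
      by (simp add: jacobi01_inner_def beta_weight_reflect)
  qed
  have "degree r \<le> k"
    unfolding r_def p_def using degree_jacobi01_le[of \<alpha> k] by (simp add: degree_pcompose)
  moreover have "jacobi01_inner \<alpha> (poly r) (poly g) = 0" if "degree g < k" for g
  proof -
    define g' where "g' = pcompose g [:1, -1:]"
    have "jacobi01_inner \<alpha> (poly r) (poly g) = jacobi01_inner \<alpha> (\<lambda>t. poly p (1 - t)) (\<lambda>t. poly g' (1 - t))"
      by (simp add: r g'_def poly_pcompose jacobi01_inner_def)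
    also have "\<dots> = jacobi01_inner \<alpha> (poly p) (poly g')"
      by (intro refl continuous_intros)
    also have "\<dots> = 0"
      unfolding p_def by (rule jacobi01_orthogonal) (use assms that in \<open>auto simp: g'_def degree_pcompose\<close>)
    finally show ?thesis .
  qed
  ultimately obtain c where c: "r = smult c p"
    using jacobi01_unique[OF assms, of r k] unfolding p_def by blast
  have "jacobi01_inner \<alpha> (poly p) (poly p) = jacobi01_inner \<alpha> (\<lambda>t. poly p (1 - t)) (\<lambda>t. poly p (1 - t))"
    by (intro refl[symmetric] continuous_intros)
  also have "\<dots> = jacobi01_inner \<alpha> (poly (smult c p)) (poly (smult c p))"
  proof -
    have "(\<lambda>t. poly p (1 - t)) = poly (smult c p)"
      unfolding c[symmetric] by (simp add: r fun_eq_iff)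
    thus ?thesis by (simp only:)
  qed
  also have "\<dots> = c * c * jacobi01_inner \<alpha> (poly p) (poly p)"
    using assms by (simp add: jacobi01_inner_poly_linear del: poly_smult)
  finally have "c\<^sup>2 = 1"
    using jacobi01_norm_pos[OF assms, of k] by (simp add: p_def power2_eq_square)
  hence "\<bar>c\<bar> = 1" by (auto simp: power2_eq_1_iff)
  moreover have "poly (jacobi01 \<alpha> k) (1 - t) = c * poly (jacobi01 \<alpha> k) t" for t
    using r[of t] c by (simp add: p_def)
  ultimately show ?thesis using that by blast
qed

text \<open>
  Sonin's argument: by the differential equation, \<open>G = p\<^sup>2 + t (1 - t) p'\<^sup>2 / \<lambda>\<close> has the derivative
  \<open>- (2\<alpha> + 1) (1 - 2 t) p'\<^sup>2 / \<lambda>\<close>, which is \<open>\<le> 0\<close> on the left half of the interval. There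
  \<open>G(t) \<le> G(0) = 1\<close>, and the right half follows by symmetry.
\<close>

lemma jacobi01_energy_le_1:
  assumes \<alpha>: "\<alpha> \<ge> 0" and k: "k > 0" and t: "t \<in> {0..1}"
  shows "(poly (jacobi01 \<alpha> k) t)\<^sup>2
      + t * (1 - t) * (poly (pderiv (jacobi01 \<alpha> k)) t)\<^sup>2 / jacobi_eigenvalue \<alpha> k \<le> 1"
proof -
  define p where "p = jacobi01 \<alpha> k"
  define ev where "ev = jacobi_eigenvalue \<alpha> k"
  define G where "G = (\<lambda>t. (poly p t)\<^sup>2 + t * (1 - t) * (poly (pderiv p) t)\<^sup>2 / ev)"
  have ev: "ev > 0" using eigenvalue_pos \<alpha> k by (simp add: ev_def)
  have half: "G t \<le> 1" if "t \<in> {0..1/2}" for t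
  proof -
    have "G t \<le> G 0"
    proof (rule DERIV_nonpos_imp_nonincreasing[where f = G])
      fix s :: real assume s: "0 \<le> s" "s \<le> t"
      define D where "D = poly (pderiv p) s"
      define DD where "DD = poly (pderiv (pderiv p)) s"
      have G': "(G has_real_derivative (2 * poly p s * D
          + ((1 - 2 * s) * D\<^sup>2 + s * (1 - s) * (2 * D * DD)) / ev)) (at s)"
      proof -
        define q where "q = p * p + smult (1 / ev) ([:0, 1, -1:] * (pderiv p * pderiv p))"
        have "G = poly q"
          by (simp add: G_def q_def fun_eq_iff power2_eq_square algebra_simps diff_divide_distrib)
        moreover have "poly (pderiv q) s = 2 * poly p s * D
            + ((1 - 2 * s) * D\<^sup>2 + s * (1 - s) * (2 * D * DD)) / ev"
          by (simp add: q_def D_def DD_def pderiv_add pderiv_mult pderiv_smult pderiv_pCons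
              power2_eq_square pderiv_minus add_divide_distrib diff_divide_distrib algebra_simps)
        ultimately show ?thesis using poly_DERIV[of q s] by simp
      qed
      have "s * (1 - s) * DD = - (\<alpha> + 1) * (1 - 2 * s) * D - ev * poly p s"
        using jacobi_ode[OF \<alpha>, of s k] unfolding D_def DD_def ev_def p_def by algebra
      hence by_ode: "(1 - 2 * s) * D\<^sup>2 + s * (1 - s) * (2 * D * DD) =
          - (2 * \<alpha> + 1) * (1 - 2 * s) * D\<^sup>2 - 2 * ev * poly p s * D"
        by algebra
      have G'_eq: "2 * poly p s * D + ((1 - 2 * s) * D\<^sup>2 + s * (1 - s) * (2 * D * DD)) / ev =
          - ((2 * \<alpha> + 1) * (1 - 2 * s) * D\<^sup>2 / ev)"
        unfolding by_ode using ev by (simp add: field_simps)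
      have nonneg: "(2 * \<alpha> + 1) * (1 - 2 * s) * D\<^sup>2 / ev \<ge> 0"
        using \<alpha> s that ev by (intro divide_nonneg_pos mult_nonneg_nonneg) auto
      show "\<exists>y. DERIV G s :> y \<and> y \<le> 0"
        using G' nonneg unfolding G'_eq
        by (intro exI[of _ "- ((2 * \<alpha> + 1) * (1 - 2 * s) * D\<^sup>2 / ev)"]) simp
    qed (use that in auto)
    also have "G 0 = 1" by (simp add: G_def p_def poly_jacobi01_0)
    finally show ?thesis .
  qed
  have "G t \<le> 1"
  proof (cases "t \<le> 1/2")
    case True
    thus ?thesis using half t by simp
  next
    case False
    obtain c where c: "\<bar>c\<bar> = 1" "\<And>t. poly p (1 - t) = c * poly p t"
      using jacobi01_reflect[OF \<alpha>] unfolding p_def by metis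
    have "((\<lambda>t. poly p (1 - t)) has_real_derivative poly (pderiv p) (1 - t) * (- 1)) (at t)"
      by (rule DERIV_chain2[OF poly_DERIV]) (auto intro!: derivative_eq_intros)
    moreover have "((\<lambda>t. poly p (1 - t)) has_real_derivative c * poly (pderiv p) t) (at t)"
      unfolding c(2) by (intro DERIV_cmult poly_DERIV)
    ultimately have "poly (pderiv p) (1 - t) * (- 1) = c * poly (pderiv p) t"
      by (rule DERIV_unique)
    hence D: "poly (pderiv p) (1 - t) = - c * poly (pderiv p) t" by simp
    have "c\<^sup>2 = 1" using c(1) by (metis power2_abs power_one)
    hence "G (1 - t) = G t"
      by (simp add: G_def c(2) D power_mult_distrib mult.commute)
    thus ?thesis using half[of "1 - t"] False t by simp
  qed
  thus ?thesis by (simp add: G_def p_def ev_def)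
qed

lemma jacobi01_abs_le_1:
  assumes "\<alpha> \<ge> 0" "t \<in> {0..1}"
  shows "\<bar>poly (jacobi01 \<alpha> k) t\<bar> \<le> 1"
proof (cases "k = 0")
  case False
  have "t * (1 - t) * (poly (pderiv (jacobi01 \<alpha> k)) t)\<^sup>2 / jacobi_eigenvalue \<alpha> k \<ge> 0"
    using assms eigenvalue_nonneg by (intro divide_nonneg_nonneg mult_nonneg_nonneg) auto
  hence "(poly (jacobi01 \<alpha> k) t)\<^sup>2 \<le> 1"
    using jacobi01_energy_le_1[of \<alpha> k t] assms False by simp
  thus ?thesis by (simp add: abs_square_le_1)
qed (simp add: jacobi01_0)

text \<open>
  The energy bound controls \<open>t (1 - t) p'\<^sup>2\<close>; one more factor \<open>t (1 - t) \<le> 1\<close> makes it a square. The gain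
  over the Markov bound below, \<open>k\<close> instead of \<open>k\<^sup>2\<close>, is what the estimate of the Hahn coefficients needs.
\<close>

lemma jacobi01_bernstein_inequality:
  assumes "\<alpha> \<ge> 0" "t \<in> {0..1}"
  shows "t * (1 - t) * \<bar>poly (pderiv (jacobi01 \<alpha> k)) t\<bar> \<le> sqrt (jacobi_eigenvalue \<alpha> k)"
proof (cases "k = 0")
  case True
  thus ?thesis by (simp add: jacobi01_0 jacobi_eigenvalue_def)
next
  case False
  define D where "D = poly (pderiv (jacobi01 \<alpha> k)) t"
  have ev: "jacobi_eigenvalue \<alpha> k > 0" using eigenvalue_pos assms False by simp
  have "t * (1 - t) * D\<^sup>2 / jacobi_eigenvalue \<alpha> k \<le> 1"
    using jacobi01_energy_le_1[of \<alpha> k t] assms False zero_le_power2[of "poly (jacobi01 \<alpha> k) t"]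
    unfolding D_def by linarith
  hence "t * (1 - t) * D\<^sup>2 \<le> jacobi_eigenvalue \<alpha> k"
    using ev by simp
  moreover have "(t * (1 - t)) * (t * (1 - t) * D\<^sup>2) \<le> 1 * (t * (1 - t) * D\<^sup>2)"
    using assms by (intro mult_right_mono mult_le_one mult_nonneg_nonneg) auto
  ultimately have "(t * (1 - t) * \<bar>D\<bar>)\<^sup>2 \<le> jacobi_eigenvalue \<alpha> k"
    by (simp only: power_mult_distrib power2_abs) (simp add: power2_eq_square mult_ac)
  thus ?thesis unfolding D_def by (rule real_le_rsqrt)
qed

text \<open>
  The derivative is itself a multiple of a Jacobi polynomial, and that polynomial is bounded by \<open>1\<close>.
\<close>

lemma jacobi01_markov_inequality:
  assumes "\<alpha> \<ge> 0" "t \<in> {0..1}"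
  shows "\<bar>poly (pderiv (jacobi01 \<alpha> k)) t\<bar> \<le> jacobi_eigenvalue \<alpha> k / (\<alpha> + 1)"
proof (cases k)
  case 0
  thus ?thesis by (simp add: jacobi01_0 jacobi_eigenvalue_def)
next
  case (Suc m)
  have "\<bar>poly (jacobi01 (\<alpha> + 1) m) t\<bar> \<le> 1" using assms by (intro jacobi01_abs_le_1) auto
  hence "jacobi_eigenvalue \<alpha> k / (\<alpha> + 1) * \<bar>poly (jacobi01 (\<alpha> + 1) m) t\<bar> \<le> jacobi_eigenvalue \<alpha> k / (\<alpha> + 1) * 1"
    using assms eigenvalue_nonneg by (intro mult_left_mono divide_nonneg_nonneg) auto
  thus ?thesis using assms eigenvalue_nonneg[of \<alpha> k]
    by (simp add: Suc pderiv_jacobi01_Suc abs_mult)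
qed

text \<open>
  The differential equation expresses \<open>t (1 - t) p''\<close> through \<open>p'\<close> and \<open>p\<close>.
\<close>

lemma jacobi01_second_derivative_bound:
  assumes "\<alpha> \<ge> 0" "t \<in> {0..1}"
  shows "t * (1 - t) * \<bar>poly (pderiv (pderiv (jacobi01 \<alpha> k))) t\<bar> \<le> 2 * jacobi_eigenvalue \<alpha> k"
proof -
  define ev where "ev = jacobi_eigenvalue \<alpha> k"
  define p where "p = jacobi01 \<alpha> k"
  have "t * (1 - t) * \<bar>poly (pderiv (pderiv p)) t\<bar> = \<bar>t * (1 - t) * poly (pderiv (pderiv p)) t\<bar>"
    using assms by (simp add: abs_mult)
  also have "t * (1 - t) * poly (pderiv (pderiv p)) t =
      - ((\<alpha> + 1) * ((1 - 2 * t) * poly (pderiv p) t) + ev * poly p t)"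
    using jacobi_ode[OF assms(1), of t k] by (simp add: p_def ev_def mult.assoc)
  also have "\<bar>\<dots>\<bar> \<le> (\<alpha> + 1) * (\<bar>1 - 2 * t\<bar> * \<bar>poly (pderiv p) t\<bar>) + ev * \<bar>poly p t\<bar>"
    using assms eigenvalue_nonneg[of \<alpha> k]
    by (intro order.trans[OF eq_refl[OF abs_minus_cancel] order.trans[OF abs_triangle_ineq]])
       (simp add: abs_mult ev_def)
  also have "\<dots> \<le> (\<alpha> + 1) * (1 * (ev / (\<alpha> + 1))) + ev * 1"
    using assms eigenvalue_nonneg[of \<alpha> k] jacobi01_abs_le_1[OF assms, of k]
      jacobi01_markov_inequality[OF assms, of k]
    by (intro add_mono mult_left_mono mult_mono) (auto simp: p_def ev_def)
  also have "\<dots> = 2 * ev" using assms by simp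
  finally show ?thesis by (simp add: p_def ev_def)
qed

section \<open>Bernstein polynomials\<close>

lemma continuous_on_real_poly: "continuous_on S (poly (p :: real poly))"
  using continuous_on_poly[OF continuous_on_id, of S p] by simp

definition bernstein_op :: "nat \<Rightarrow> (nat \<Rightarrow> real) \<Rightarrow> real \<Rightarrow> real" where
  "bernstein_op N g t = (\<Sum>i\<le>N. g i * Bernstein N i t)"

lemma continuous_on_bernstein_op [continuous_intros]: "continuous_on S (bernstein_op N g)"
  unfolding bernstein_op_def Bernstein_def by (intro continuous_intros)

text \<open>
  These are the factorial moments of the binomial distribution: absorb the falling factorial of \<open>i\<close> into
  the binomial coefficient and sum what remains with the binomial theorem.
\<close>

lemma bernstein_op_pochhammer:
  assumes "j \<le> N"
  shows "bernstein_op N (\<lambda>i. pochhammer (- real i) j) t = pochhammer (- real N) j * t ^ j"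
proof -
  have poch: "pochhammer (- real i) j = (-1) ^ j * fact j * real (i choose j)" for i
  proof -
    have "(-1) ^ j * fact j * real (i choose j) = ((-1) ^ j * (-1) ^ j) * pochhammer (- real i) j"
      by (simp only: binomial_gbinomial gbinomial_pochhammer) simp
    thus ?thesis by simp
  qed
  have "(\<Sum>i\<le>N. real ((N choose i) * (i choose j)) * t ^ i * (1 - t) ^ (N - i)) =
      (\<Sum>i=j..N. real ((N choose i) * (i choose j)) * t ^ i * (1 - t) ^ (N - i))"
    by (rule sum.mono_neutral_right) auto
  also have "\<dots> = (\<Sum>m\<le>N - j. real (N choose j) * t ^ j * Bernstein (N - j) m t)"
  proof (rule sum.reindex_bij_witness[where i = "\<lambda>m. m + j" and j = "\<lambda>i. i - j"])
    fix i assume i: "i \<in> {j..N}"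
    have "(N choose i) * (i choose j) = (N choose j) * ((N - j) choose (i - j))"
      using i by (intro choose_mult) auto
    moreover have "t ^ i = t ^ j * t ^ (i - j)" using i by (simp flip: power_add)
    ultimately show "real (N choose j) * t ^ j * Bernstein (N - j) (i - j) t =
        real ((N choose i) * (i choose j)) * t ^ i * (1 - t) ^ (N - i)"
      using i by (simp add: Bernstein_def)
  qed (use assms in auto)
  also have "\<dots> = real (N choose j) * t ^ j"
    by (simp add: sum_distrib_left[symmetric])
  finally have "(\<Sum>i\<le>N. real ((N choose i) * (i choose j)) * t ^ i * (1 - t) ^ (N - i)) =
      real (N choose j) * t ^ j" .
  moreover have "bernstein_op N (\<lambda>i. pochhammer (- real i) j) t = (-1) ^ j * fact j *
      (\<Sum>i\<le>N. real ((N choose i) * (i choose j)) * t ^ i * (1 - t) ^ (N - i))"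
    unfolding bernstein_op_def sum_distrib_left poch Bernstein_def
    by (intro sum.cong refl) (simp add: mult_ac)
  ultimately show ?thesis by (simp add: poch)
qed

text \<open>
  The hypergeometric sums of \<open>Q\<^sub>k\<close> and \<open>p\<^sub>k\<close> have the same coefficients; only \<open>t\<^sup>j\<close> is replaced by a quotient
  of Pochhammer symbols, which the Bernstein operator turns back into \<open>t\<^sup>j\<close>.
\<close>

lemma bernstein_op_hahn:
  assumes "\<alpha> \<ge> 0" "k \<le> N"
  shows "bernstein_op N (\<lambda>i. hahn_poly \<alpha> \<alpha> N k (real i)) = poly (jacobi01 \<alpha> k)"
proof
  fix t
  have "bernstein_op N (\<lambda>i. hahn_poly \<alpha> \<alpha> N k (real i)) t =
      (\<Sum>i\<le>N. \<Sum>j\<le>k. jacobi_coeff \<alpha> k j / pochhammer (- real N) j * (pochhammer (- real i) j * Bernstein N i t))"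
  proof -
    have "real k + \<alpha> + \<alpha> + 1 = real k + 2 * \<alpha> + 1" by simp
    thus ?thesis
      unfolding bernstein_op_def hahn_poly_def sum_distrib_right jacobi_coeff_def
      by (intro sum.cong refl) (simp only: mult_ac divide_inverse inverse_mult_distrib)
  qed
  also have "\<dots> = (\<Sum>j\<le>k. jacobi_coeff \<alpha> k j / pochhammer (- real N) j * bernstein_op N (\<lambda>i. pochhammer (- real i) j) t)"
    unfolding bernstein_op_def sum_distrib_left by (rule sum.swap)
  also have "\<dots> = (\<Sum>j\<le>k. jacobi_coeff \<alpha> k j * t ^ j)"
  proof (intro sum.cong refl)
    fix j assume "j \<in> {..k}"
    hence j: "j \<le> N" using assms by simp
    hence "pochhammer (- real N) j \<noteq> 0" by (simp add: pochhammer_of_nat_eq_0_iff)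
    thus "jacobi_coeff \<alpha> k j / pochhammer (- real N) j * bernstein_op N (\<lambda>i. pochhammer (- real i) j) t
        = jacobi_coeff \<alpha> k j * t ^ j"
      by (simp add: bernstein_op_pochhammer[OF j])
  qed
  also have "\<dots> = poly (jacobi01 \<alpha> k) t"
    by (simp add: jacobi01_def poly_sum poly_monom)
  finally show "bernstein_op N (\<lambda>i. hahn_poly \<alpha> \<alpha> N k (real i)) t = poly (jacobi01 \<alpha> k) t" .
qed

text \<open>
  Since \<open>t (1 - t) b' = (i - N t) b\<close> for each basis polynomial \<open>b\<close>, multiplication by the index \<open>i\<close> turns into
  a first-order differential operator on the image. It raises the degree by at most one, and that is why
  the Bernstein operator does not increase degrees.
\<close>

lemma bernstein_op_times_index:
  fixes P :: "real poly"
  assumes "bernstein_op N g = poly P"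
  shows "bernstein_op N (\<lambda>i. real i * g i) = poly (smult (real N) ([:0, 1:] * P) + [:0, 1, -1:] * pderiv P)"
proof
  fix t :: real
  have Bernstein': "((\<lambda>t. Bernstein N i t) has_real_derivative
      real (N choose i) * (real i * t ^ (i - 1) * (1 - t) ^ (N - i) - real (N - i) * (1 - t) ^ (N - i - 1) * t ^ i)) (at t)" for i
    unfolding Bernstein_def
    by (auto intro!: derivative_eq_intros simp: algebra_simps)
  have index: "t * (1 - t) * (real (N choose i) * (real i * t ^ (i - 1) * (1 - t) ^ (N - i)
      - real (N - i) * (1 - t) ^ (N - i - 1) * t ^ i)) = (real i - real N * t) * Bernstein N i t"
    if "i \<le> N" for i
  proof -
    have "t * (real i * t ^ (i - 1)) = real i * t ^ i" by (cases i) auto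
    moreover have "(1 - t) * (real (N - i) * (1 - t) ^ (N - i - 1)) = real (N - i) * (1 - t) ^ (N - i)"
      by (cases "N - i") auto
    moreover have "real (N - i) = real N - real i" using that by simp
    moreover have "t * (1 - t) * (c * (I * A' * B - M * B' * A)) = (I - n * t) * (c * A * B)"
      if "t * (I * A') = I * A" "(1 - t) * (M * B') = M * B" "M = n - I" for I A A' B B' M n c :: real
      using that by algebra
    ultimately show ?thesis unfolding Bernstein_def by blast
  qed
  have "(bernstein_op N g has_real_derivative (\<Sum>i\<le>N. g i * (real (N choose i) * (real i * t ^ (i - 1) * (1 - t) ^ (N - i)
      - real (N - i) * (1 - t) ^ (N - i - 1) * t ^ i)))) (at t)"
    unfolding bernstein_op_def by (intro DERIV_sum DERIV_cmult Bernstein')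
  hence "poly (pderiv P) t = (\<Sum>i\<le>N. g i * (real (N choose i) * (real i * t ^ (i - 1) * (1 - t) ^ (N - i)
      - real (N - i) * (1 - t) ^ (N - i - 1) * t ^ i)))"
    unfolding assms using poly_DERIV DERIV_unique by blast
  hence "t * (1 - t) * poly (pderiv P) t = (\<Sum>i\<le>N. g i * (t * (1 - t) * (real (N choose i) * (real i * t ^ (i - 1) * (1 - t) ^ (N - i)
      - real (N - i) * (1 - t) ^ (N - i - 1) * t ^ i))))"
    by (simp only: sum_distrib_left mult_ac)
  also have "\<dots> = (\<Sum>i\<le>N. g i * ((real i - real N * t) * Bernstein N i t))"
    by (intro sum.cong refl arg_cong2[where f = "(*)"] index) auto
  also have "\<dots> = bernstein_op N (\<lambda>i. real i * g i) t - real N * t * poly P t"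
    unfolding assms[symmetric] bernstein_op_def
    by (simp add: sum_subtractf[symmetric] sum_distrib_left algebra_simps)
  finally show "bernstein_op N (\<lambda>i. real i * g i) t =
      poly (smult (real N) ([:0, 1:] * P) + [:0, 1, -1:] * pderiv P) t"
    by (simp add: algebra_simps)
qed

lemma bernstein_op_poly:
  fixes q :: "real poly"
  obtains P where "degree P \<le> degree q" "bernstein_op N (\<lambda>i. poly q (real i)) = poly P"
proof -
  have "\<exists>P. degree P \<le> degree q \<and> bernstein_op N (\<lambda>i. poly q (real i)) = poly P"
  proof (induction q)
    case 0
    show ?case by (intro exI[of _ 0]) (auto simp: bernstein_op_def)
  next
    case (pCons c q)
    then obtain P where P: "degree P \<le> degree q" "bernstein_op N (\<lambda>i. poly q (real i)) = poly P"
      by blast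
    define R where "R = smult (real N) ([:0, 1:] * P) + [:0, 1, -1:] * pderiv P"
    have "bernstein_op N (\<lambda>i. poly (pCons c q) (real i)) t =
        c * (\<Sum>i\<le>N. Bernstein N i t) + bernstein_op N (\<lambda>i. real i * poly q (real i)) t" for t
      unfolding bernstein_op_def by (simp add: sum_distrib_left sum.distrib[symmetric] algebra_simps del: sum_Bernstein)
    hence eq: "bernstein_op N (\<lambda>i. poly (pCons c q) (real i)) = poly ([:c:] + R)"
      using bernstein_op_times_index[OF P(2)] by (simp add: fun_eq_iff R_def)
    show ?case
    proof (cases "q = 0")
      case True
      have "bernstein_op N (\<lambda>i. poly (pCons c q) (real i)) = poly [:c:]"
        by (simp add: True fun_eq_iff bernstein_op_def sum_distrib_left[symmetric])
      thus ?thesis by (intro exI[of _ "[:c:]"]) simp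
    next
      case False
      have "degree (smult (real N) ([:0, 1:] * P)) \<le> Suc (degree q)"
        using P(1) by (intro order.trans[OF degree_smult_le] order.trans[OF degree_mult_le]) simp
      moreover have "degree ([:0, 1, -1:] * pderiv P) \<le> Suc (degree q)"
      proof (cases "degree P = 0")
        case True
        hence "pderiv P = 0" by (simp add: pderiv_eq_0_iff)
        thus ?thesis by simp
      next
        case False
        thus ?thesis using P(1) by (intro order.trans[OF degree_mult_le]) (simp add: degree_pderiv)
      qed
      ultimately have "degree ([:c:] + R) \<le> Suc (degree q)"
        unfolding R_def by (intro degree_add_le) auto
      thus ?thesis using eq False by (intro exI[of _ "[:c:] + R"]) simp
    qed
  qed
  thus ?thesis using that by blast
qed

text \<open>
  With \<open>t = z / (1 + z)\<close> a combination of Bernstein polynomials becomes, up to the factor \<open>(1 + z)\<^sup>N\<close>, an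
  ordinary polynomial in \<open>z\<close> with infinitely many zeros.
\<close>

lemma Bernstein_independent:
  assumes "\<And>t. t \<in> {0<..<1} \<Longrightarrow> bernstein_op N g t = 0" "i \<le> N"
  shows "g i = 0"
proof -
  define P where "P = (\<Sum>i\<le>N. monom (g i * real (N choose i)) i)"
  have "poly P z = 0" if z: "z > 0" for z
  proof -
    define t where "t = z / (1 + z)"
    have t: "t \<in> {0<..<1}" "1 - t = 1 / (1 + z)" using z by (auto simp: t_def field_simps)
    have B: "(1 + z) ^ N * Bernstein N j t = real (N choose j) * z ^ j" if "j \<le> N" for j
    proof -
      have "(1 + z) ^ N = (1 + z) ^ j * (1 + z) ^ (N - j)"
        using that by (simp flip: power_add)
      thus ?thesis using z by (simp add: Bernstein_def t(2)) (simp add: t_def power_divide)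
    qed
    have "poly P z = (\<Sum>j\<le>N. g j * ((1 + z) ^ N * Bernstein N j t))"
      unfolding P_def poly_sum poly_monom by (intro sum.cong refl) (simp add: B)
    also have "\<dots> = (1 + z) ^ N * bernstein_op N g t"
      by (simp add: bernstein_op_def sum_distrib_left mult_ac)
    finally show ?thesis using assms(1)[OF t(1)] by simp
  qed
  hence "{0<..} \<subseteq> {z. poly P z = 0}" by auto
  hence "P = 0"
    using poly_roots_finite[of P] infinite_super[of "{0::real<..}"] infinite_Ioi by auto
  hence "coeff P i = 0" by simp
  moreover have "coeff P i = g i * real (N choose i)"
    using assms(2) by (simp add: P_def coeff_sum)
  ultimately show ?thesis using assms(2) by simp
qed

section \<open>Hahn polynomials as Beta means of Jacobi polynomials\<close>

text \<open>
  At a grid point \<open>y = i\<close> this is the mean of \<open>f\<close> with respect to the normalized density \<open>b\<^sub>N\<^sub>,\<^sub>i w\<close>. The same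
  formula makes sense for all real \<open>y\<close> in \<open>[0, N]\<close>, which is where the Hahn polynomials are evaluated in
  the expansion.
\<close>

definition beta_sample :: "real \<Rightarrow> nat \<Rightarrow> (real \<Rightarrow> real) \<Rightarrow> real \<Rightarrow> real" where
  "beta_sample \<alpha> N f y = beta_mean (\<alpha> + y) (\<alpha> + real N - y) f"

definition hahn_scale :: "real \<Rightarrow> nat \<Rightarrow> real" where
  "hahn_scale \<alpha> N = Gamma (real N + 2 * \<alpha> + 2) / (fact N * (Gamma (\<alpha> + 1))\<^sup>2)"

text \<open>
  The product of the binomial coefficient with the Beta function is the integral of \<open>b\<^sub>N\<^sub>,\<^sub>i w\<close>.
\<close>

lemma hahn_weight_eq:
  assumes "\<alpha> \<ge> 0" "i \<le> N"
  shows "hahn_weight \<alpha> N i =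
    hahn_scale \<alpha> N * (real (N choose i) * Beta (\<alpha> + real i + 1) (\<alpha> + real (N - i) + 1))"
proof -
  define G where "G = Gamma (real N + 2 * \<alpha> + 2)"
  have "G > 0" unfolding G_def using assms by (intro Gamma_real_pos) auto
  have "\<alpha> + real i + 1 + (\<alpha> + real (N - i) + 1) = real N + 2 * \<alpha> + 2"
    using assms(2) by simp
  hence Beta_eq: "Beta (\<alpha> + real i + 1) (\<alpha> + real (N - i) + 1) =
      Gamma (\<alpha> + real i + 1) * Gamma (\<alpha> + real (N - i) + 1) / G"
    by (simp only: Beta_def G_def)
  have binomial_eq: "gamma_binomial (\<alpha> + real m) (real m) = Gamma (\<alpha> + real m + 1) / (fact m * Gamma (\<alpha> + 1))" for m
  proof -
    have "\<alpha> + real m - real m + 1 = \<alpha> + 1" by simp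
    thus ?thesis
      by (simp only: gamma_binomial_def) (simp add: Gamma_fact add.commute)
  qed
  show ?thesis
    unfolding hahn_weight_def binomial_eq hahn_scale_def Beta_eq binomial_fact[OF assms(2)] G_def[symmetric]
    using \<open>G > 0\<close> by (simp add: power2_eq_square)
qed

lemma hahn_scale_pos: "\<alpha> \<ge> 0 \<Longrightarrow> hahn_scale \<alpha> N > 0"
  unfolding hahn_scale_def
  by (intro divide_pos_pos mult_pos_pos zero_less_power Gamma_real_pos) auto

text \<open>
  Both sides are the sum over \<open>i\<close> of \<open>g i\<close> times the integral of \<open>b\<^sub>N\<^sub>,\<^sub>i f w\<close>. So, up to a constant, sampling
  by Beta means is adjoint to the Bernstein operator.
\<close>

lemma hahn_jacobi_duality:
  assumes "\<alpha> \<ge> 0" "continuous_on {0..1} f"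
  shows "hahn_inner \<alpha> N g (\<lambda>i. beta_sample \<alpha> N f (real i)) = hahn_scale \<alpha> N * jacobi01_inner \<alpha> (bernstein_op N g) f"
proof -
  have summand: "integral {0..1} (\<lambda>t. g i * Bernstein N i t * f t * beta_weight \<alpha> \<alpha> t) =
      g i * (real (N choose i) * Beta (\<alpha> + real i + 1) (\<alpha> + real (N - i) + 1)) * beta_sample \<alpha> N f (real i)"
    if i: "i \<le> N" for i
  proof -
    have "integral {0..1} (\<lambda>t. g i * Bernstein N i t * f t * beta_weight \<alpha> \<alpha> t) =
        integral {0..1} (\<lambda>t. g i * real (N choose i) * (f t * beta_weight (\<alpha> + real i) (\<alpha> + real (N - i)) t))"
    proof (rule integral_cong)
      fix t :: real assume t: "t \<in> {0..1}"
      have "beta_weight (\<alpha> + real i) (\<alpha> + real (N - i)) t = beta_weight \<alpha> \<alpha> t * (t ^ i * (1 - t) ^ (N - i))"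
        using beta_weight_add[OF assms(1) assms(1) _ _ t] beta_weight_of_nat[OF t] by simp
      thus "g i * Bernstein N i t * f t * beta_weight \<alpha> \<alpha> t =
          g i * real (N choose i) * (f t * beta_weight (\<alpha> + real i) (\<alpha> + real (N - i)) t)"
        by (simp add: Bernstein_def mult_ac)
    qed
    also have "\<dots> = g i * real (N choose i) * integral {0..1} (\<lambda>t. f t * beta_weight (\<alpha> + real i) (\<alpha> + real (N - i)) t)"
      by simp
    also have "integral {0..1} (\<lambda>t. f t * beta_weight (\<alpha> + real i) (\<alpha> + real (N - i)) t) =
        Beta (\<alpha> + real i + 1) (\<alpha> + real (N - i) + 1) * beta_mean (\<alpha> + real i) (\<alpha> + real (N - i)) f"
      using Beta_pos[of "\<alpha> + real i + 1" "\<alpha> + real (N - i) + 1"] assms(1) by (simp add: beta_mean_def)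
    also have "beta_mean (\<alpha> + real i) (\<alpha> + real (N - i)) f = beta_sample \<alpha> N f (real i)"
      using i by (simp add: beta_sample_def add_diff_eq)
    finally show ?thesis by (simp add: mult_ac)
  qed
  have "jacobi01_inner \<alpha> (bernstein_op N g) f =
      integral {0..1} (\<lambda>t. \<Sum>i\<le>N. g i * Bernstein N i t * f t * beta_weight \<alpha> \<alpha> t)"
    by (simp add: jacobi01_inner_def bernstein_op_def sum_distrib_right)
  also have "\<dots> = (\<Sum>i\<le>N. integral {0..1} (\<lambda>t. g i * Bernstein N i t * f t * beta_weight \<alpha> \<alpha> t))"
    unfolding Bernstein_def using assms
    by (intro integral_sum integrable_continuous_real continuous_intros) auto
  also have "\<dots> = (\<Sum>i\<le>N. g i * (real (N choose i) * Beta (\<alpha> + real i + 1) (\<alpha> + real (N - i) + 1)) * beta_sample \<alpha> N f (real i))"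
    by (intro sum.cong refl summand) auto
  finally show ?thesis
    unfolding hahn_inner_def using assms(1)
    by (simp add: sum_distrib_left hahn_weight_eq mult_ac)
qed

text \<open>
  By \<open>beta_mean_times_id\<close>, a factor \<open>t\<close> under the mean becomes a factor linear in \<open>y\<close>, together with a
  shift of the first exponent. The exponent \<open>a\<close> is therefore generalized in the induction.
\<close>

lemma beta_sample_poly:
  fixes q :: "real poly"
  assumes "\<alpha> \<ge> 0"
  obtains r where "degree r \<le> degree q"
    "\<And>y. y \<in> {0..real N} \<Longrightarrow> beta_sample \<alpha> N (poly q) y = poly r y"
proof -
  have "\<exists>r. degree r \<le> degree q \<and> (\<forall>y\<in>{0..real N}. beta_mean (a + y) (\<alpha> + real N - y) (poly q) = poly r y)"
    if "a \<ge> 0" for a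
    using that
  proof (induction q arbitrary: a)
    case 0
    show ?case by (intro exI[of _ 0]) (simp add: beta_mean_def)
  next
    case (pCons c q)
    obtain r where r: "degree r \<le> degree q"
      "\<And>y. y \<in> {0..real N} \<Longrightarrow> beta_mean (a + 1 + y) (\<alpha> + real N - y) (poly q) = poly r y"
      using pCons.IH[of "a + 1"] pCons.prems by auto
    define R where "R = [:c:] + smult (1 / (a + \<alpha> + real N + 2)) ([:a + 1, 1:] * r)"
    have eq: "beta_mean (a + y) (\<alpha> + real N - y) (poly (pCons c q)) = poly R y"
      if y: "y \<in> {0..real N}" for y
    proof -
      have ab: "a + y \<ge> 0" "\<alpha> + real N - y \<ge> 0" using y assms pCons.prems by auto
      have "beta_mean (a + y) (\<alpha> + real N - y) (poly (pCons c q)) =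
          beta_mean (a + y) (\<alpha> + real N - y) (\<lambda>t. c + poly q t * t)"
        by (rule arg_cong[where f = "beta_mean (a + y) (\<alpha> + real N - y)"]) (simp add: fun_eq_iff)
      also have "\<dots> = beta_mean (a + y) (\<alpha> + real N - y) (\<lambda>t. c)
          + beta_mean (a + y) (\<alpha> + real N - y) (\<lambda>t. poly q t * t)"
        by (intro beta_mean_add ab continuous_intros)
      also have "\<dots> = c + (a + y + 1) / (a + \<alpha> + real N + 2) * beta_mean (a + y + 1) (\<alpha> + real N - y) (poly q)"
        unfolding beta_mean_const[OF ab] beta_mean_times_id[OF ab] by (simp add: add_ac)
      also have "beta_mean (a + y + 1) (\<alpha> + real N - y) (poly q) = poly r y"
        using r(2)[OF y] by (simp add: add_ac)
      also have "c + (a + y + 1) / (a + \<alpha> + real N + 2) * poly r y = poly R y"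
        by (simp add: R_def algebra_simps add_divide_distrib)
      finally show ?thesis .
    qed
    show ?case
    proof (cases "q = 0")
      case True
      have "beta_mean (a + y) (\<alpha> + real N - y) (poly (pCons c q)) = poly [:c:] y" if "y \<in> {0..real N}" for y
      proof -
        have "poly [:c:] = (\<lambda>t. c)" by (simp add: fun_eq_iff)
        thus ?thesis
          using that beta_mean_const[of "a + y" "\<alpha> + real N - y" c] assms pCons.prems by (simp add: True)
      qed
      moreover have "degree [:c:] \<le> degree (pCons c q)" by simp
      ultimately show ?thesis by blast
    next
      case False
      have "degree (smult (1 / (a + \<alpha> + real N + 2)) ([:a + 1, 1:] * r)) \<le> Suc (degree q)"
        using r(1) by (intro order.trans[OF degree_smult_le] order.trans[OF degree_mult_le]) simp
      hence "degree R \<le> Suc (degree q)"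
        unfolding R_def by (intro degree_add_le) auto
      hence "degree R \<le> degree (pCons c q)" using False by simp
      thus ?thesis using eq by blast
    qed
  qed
  from this[OF assms] show ?thesis using that unfolding beta_sample_def by blast
qed

lemma hahn_poly_is_poly:
  obtains q where "degree q \<le> k" "\<And>y. hahn_poly \<alpha> \<beta> N k y = poly q y"
proof -
  have poch: "\<exists>q. degree q \<le> j \<and> (\<forall>y::real. pochhammer (- y) j = poly q y)" for j
  proof (induction j)
    case 0
    show ?case by (intro exI[of _ 1]) simp
  next
    case (Suc j)
    then obtain q where q: "degree q \<le> j" "\<And>y::real. pochhammer (- y) j = poly q y" by blast
    have "degree (q * [:real j, -1:]) \<le> Suc j"
      using q(1) by (intro order.trans[OF degree_mult_le]) simp
    thus ?case using q(2)
      by (intro exI[of _ "q * [:real j, -1:]"]) (simp add: pochhammer_Suc algebra_simps)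
  qed
  then obtain q where q: "\<And>j. degree (q j) \<le> j" "\<And>j y::real. pochhammer (- y) j = poly (q j) y"
    by metis
  define c where "c = (\<lambda>j. pochhammer (- real k) j * pochhammer (real k + \<alpha> + \<beta> + 1) j
               / (pochhammer (\<alpha> + 1) j * pochhammer (- real N) j * fact j))"
  have "degree (\<Sum>j\<le>k. smult (c j) (q j)) \<le> k"
    using q(1) by (intro degree_sum_le) (auto intro: order.trans[OF degree_smult_le] order.trans)
  moreover have "hahn_poly \<alpha> \<beta> N k y = poly (\<Sum>j\<le>k. smult (c j) (q j)) y" for y
    unfolding hahn_poly_def poly_sum by (intro sum.cong refl) (simp add: q(2) c_def)
  ultimately show ?thesis using that by blast
qed

lemma hahn_poly_at_0: "hahn_poly \<alpha> \<beta> N k 0 = 1"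
proof -
  have "hahn_poly \<alpha> \<beta> N k 0 = (\<Sum>j\<le>k. if j = 0 then 1 else 0)"
    unfolding hahn_poly_def by (intro sum.cong) (auto simp: pochhammer_0_left)
  thus ?thesis by simp
qed

text \<open>
  Let \<open>r\<close> be the polynomial that gives the Beta means of \<open>p\<^sub>k\<close>. Moving the two adjoint operators back and
  forth shows that \<open>B r\<close> is orthogonal to all lower degrees, hence \<open>B r = c p\<^sub>k = c B Q\<^sub>k\<close>. By injectivity
  \<open>r = c Q\<^sub>k\<close> on the grid, and as \<open>N + 1\<close> points determine polynomials of degree at most \<open>k \<le> N\<close>,
  also off the grid. The value at \<open>0\<close> identifies the constant.
\<close>

lemma beta_sample_jacobi:
  assumes \<alpha>: "\<alpha> \<ge> 0" and k: "k \<le> N" and y: "y \<in> {0..real N}"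
  shows "beta_sample \<alpha> N (poly (jacobi01 \<alpha> k)) y =
    beta_sample \<alpha> N (poly (jacobi01 \<alpha> k)) 0 * hahn_poly \<alpha> \<alpha> N k y"
proof -
  define p where "p = jacobi01 \<alpha> k"
  note dual = hahn_jacobi_duality[OF \<alpha> continuous_on_real_poly]
  obtain r where r: "degree r \<le> k" "\<And>y. y \<in> {0..real N} \<Longrightarrow> beta_sample \<alpha> N (poly p) y = poly r y"
    using beta_sample_poly[OF \<alpha>, of p N] degree_jacobi01_le[of \<alpha> k] order.trans unfolding p_def by metis
  obtain P where P: "degree P \<le> degree r" "bernstein_op N (\<lambda>i. poly r (real i)) = poly P"
    by (rule bernstein_op_poly)
  have "jacobi01_inner \<alpha> (poly P) (poly g) = 0" if g: "degree g < k" for g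
  proof -
    obtain s where s: "degree s \<le> degree g" "\<And>y. y \<in> {0..real N} \<Longrightarrow> beta_sample \<alpha> N (poly g) y = poly s y"
      using beta_sample_poly[OF \<alpha>, of g N] by metis
    obtain S where S: "degree S \<le> degree s" "bernstein_op N (\<lambda>i. poly s (real i)) = poly S"
      by (rule bernstein_op_poly)
    have "hahn_scale \<alpha> N * jacobi01_inner \<alpha> (poly P) (poly g) =
        hahn_inner \<alpha> N (\<lambda>i. poly r (real i)) (\<lambda>i. beta_sample \<alpha> N (poly g) (real i))"
      by (simp add: dual P(2))
    also have "\<dots> = hahn_inner \<alpha> N (\<lambda>i. poly s (real i)) (\<lambda>i. beta_sample \<alpha> N (poly p) (real i))"
      unfolding hahn_inner_def by (intro sum.cong refl) (simp add: r(2) s(2))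
    also have "\<dots> = hahn_scale \<alpha> N * jacobi01_inner \<alpha> (poly S) (poly p)"
      by (simp add: dual S(2))
    also have "jacobi01_inner \<alpha> (poly S) (poly p) = jacobi01_inner \<alpha> (poly p) (poly S)"
      by (simp add: jacobi01_inner_def mult_ac)
    also have "\<dots> = 0"
      unfolding p_def using g S(1) s(1) \<alpha> by (intro jacobi01_orthogonal) auto
    finally show ?thesis using hahn_scale_pos[OF \<alpha>, of N] by simp
  qed
  then obtain c where c: "P = smult c p"
    using jacobi01_unique[OF \<alpha>, of P k] P(1) r(1) unfolding p_def by (meson order.trans)
  have grid: "poly r (real i) - c * hahn_poly \<alpha> \<alpha> N k (real i) = 0" if i: "i \<le> N" for i
  proof (rule Bernstein_independent[where N = N])
    fix t :: real
    have "bernstein_op N (\<lambda>i. poly r (real i) - c * hahn_poly \<alpha> \<alpha> N k (real i)) t =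
        bernstein_op N (\<lambda>i. poly r (real i)) t - c * bernstein_op N (\<lambda>i. hahn_poly \<alpha> \<alpha> N k (real i)) t"
      by (simp add: bernstein_op_def sum_subtractf sum_distrib_left algebra_simps)
    also have "\<dots> = 0"
      unfolding P(2) c bernstein_op_hahn[OF \<alpha> k] by (simp add: p_def)
    finally show "bernstein_op N (\<lambda>i. poly r (real i) - c * hahn_poly \<alpha> \<alpha> N k (real i)) t = 0" .
  qed (rule i)
  obtain q where q: "degree q \<le> k" "\<And>y. hahn_poly \<alpha> \<alpha> N k y = poly q y"
    using hahn_poly_is_poly[of k \<alpha> \<alpha> N] by metis
  have "r = smult c q"
  proof (rule poly_eqI_degree[where A = "real ` {..N}"])
    show "poly r x = poly (smult c q) x" if "x \<in> real ` {..N}" for x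
      using that grid q(2) by auto
    have "card (real ` {..N}) = Suc N" by (simp add: card_image)
    thus "degree r < card (real ` {..N})" "degree (smult c q) < card (real ` {..N})"
      using r(1) q(1) k degree_smult_le[of c q] by auto
  qed
  hence eq: "beta_sample \<alpha> N (poly p) y = c * hahn_poly \<alpha> \<alpha> N k y" if "y \<in> {0..real N}" for y
    using r(2)[OF that] q(2) by simp
  from eq[OF y] eq[of 0] show ?thesis
    by (simp add: hahn_poly_at_0 p_def)
qed

text \<open>
  The mean of the density differs from \<open>y / N\<close> by at most \<open>1 / N\<close> times \<open>\<alpha> + 1\<close>, which costs \<open>\<lambda>\<^sub>k / N\<close> by the
  Markov inequality; replacing the Beta mean by the value at the mean costs \<open>2 \<lambda>\<^sub>k / N\<close>.
\<close>

lemma beta_sample_close: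
  assumes \<alpha>: "\<alpha> \<ge> 0" and N: "N > 0" and y: "y \<in> {0..real N}"
  shows "\<bar>beta_sample \<alpha> N (poly (jacobi01 \<alpha> k)) y - poly (jacobi01 \<alpha> k) (y / real N)\<bar>
    \<le> 3 * jacobi_eigenvalue \<alpha> k / real N"
proof -
  define p where "p = jacobi01 \<alpha> k"
  define ev where "ev = jacobi_eigenvalue \<alpha> k"
  define m where "m = (\<alpha> + y + 1) / (real N + 2 * \<alpha> + 2)"
  have ev: "ev \<ge> 0" using eigenvalue_nonneg \<alpha> by (simp add: ev_def)
  have "\<bar>beta_mean (\<alpha> + y) (\<alpha> + real N - y) (poly p) - poly p ((\<alpha> + y + 1) / (\<alpha> + y + (\<alpha> + real N - y) + 2))\<bar>
      \<le> 2 * ev / (\<alpha> + y + (\<alpha> + real N - y) + 3)"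
    using y \<alpha> jacobi01_second_derivative_bound[OF \<alpha>]
    by (intro beta_mean_error[where F' = "poly (pderiv p)" and F'' = "poly (pderiv (pderiv p))"] poly_DERIV)
       (auto intro!: continuous_intros simp: p_def ev_def)
  hence 1: "\<bar>beta_sample \<alpha> N (poly p) y - poly p m\<bar> \<le> 2 * ev / (real N + 2 * \<alpha> + 3)"
    by (simp add: beta_sample_def m_def add_ac)
  also have "\<dots> \<le> 2 * ev / real N"
    using ev \<alpha> N by (intro divide_left_mono) auto
  finally have 1: "\<bar>beta_sample \<alpha> N (poly p) y - poly p m\<bar> \<le> 2 * ev / real N" .
  have lip: "\<bar>poly p m - poly p (y / real N)\<bar> \<le> ev / (\<alpha> + 1) * \<bar>m - y / real N\<bar>"
  proof -
    have "norm (poly p m - poly p (y / real N)) \<le> ev / (\<alpha> + 1) * norm (m - y / real N)"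
    proof (rule field_differentiable_bound[of "{0..1}" _ "poly (pderiv p)"])
      fix t :: real assume t: "t \<in> {0..1}"
      show "(poly p has_field_derivative poly (pderiv p) t) (at t within {0..1})"
        by (rule has_field_derivative_at_within[OF poly_DERIV])
      show "norm (poly (pderiv p) t) \<le> ev / (\<alpha> + 1)"
        using jacobi01_markov_inequality[OF \<alpha> t, of k] by (simp add: p_def ev_def)
    qed (use y \<alpha> N in \<open>auto simp: m_def field_simps\<close>)
    thus ?thesis by simp
  qed
  have "m - y / real N = (\<alpha> + 1) * (real N - 2 * y) / (real N * (real N + 2 * \<alpha> + 2))"
    using N \<alpha> by (simp add: m_def divide_simps) (simp add: algebra_simps)
  also have "\<bar>\<dots>\<bar> = (\<alpha> + 1) * \<bar>real N - 2 * y\<bar> / (real N * (real N + 2 * \<alpha> + 2))"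
    using N \<alpha> by (simp add: abs_mult)
  also have "\<dots> \<le> (\<alpha> + 1) * (real N + 2 * \<alpha> + 2) / (real N * (real N + 2 * \<alpha> + 2))"
    using N \<alpha> y by (intro divide_right_mono mult_left_mono) auto
  also have "\<dots> = (\<alpha> + 1) / real N" using \<alpha> by simp
  finally have "ev / (\<alpha> + 1) * \<bar>m - y / real N\<bar> \<le> ev / (\<alpha> + 1) * ((\<alpha> + 1) / real N)"
    using ev \<alpha> by (intro mult_left_mono) auto
  also have "\<dots> = ev / real N" using \<alpha> by simp
  finally have "\<bar>poly p m - poly p (y / real N)\<bar> \<le> ev / real N" using lip by simp
  hence "\<bar>beta_sample \<alpha> N (poly p) y - poly p (y / real N)\<bar> \<le> 2 * ev / real N + ev / real N"
    using 1 by linarith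
  thus ?thesis by (simp add: p_def ev_def add_divide_distrib[symmetric])
qed

text \<open>
  Apply \<open>beta_sample_close\<close> at \<open>y = N t\<close> and also at \<open>y = 0\<close>, where it shows that the factor \<open>\<mu>\<^sub>k\<close>
  between \<open>Q\<^sub>k\<close> and the Beta mean of \<open>p\<^sub>k\<close> is close to \<open>1\<close>.
\<close>

lemma hahn_poly_close:
  assumes \<alpha>: "\<alpha> \<ge> 0" and k: "k \<le> N" and N: "N > 0" "6 * jacobi_eigenvalue \<alpha> k \<le> real N"
    and t: "t \<in> {0..1}"
  shows "beta_sample \<alpha> N (poly (jacobi01 \<alpha> k)) 0 > 0"
    and "\<bar>hahn_poly \<alpha> \<alpha> N k (real N * t)\<bar> \<le> 3"
    and "\<bar>hahn_poly \<alpha> \<alpha> N k (real N * t) - poly (jacobi01 \<alpha> k) t\<bar>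
      \<le> 12 * jacobi_eigenvalue \<alpha> k / real N"
proof -
  define p where "p = jacobi01 \<alpha> k"
  define \<epsilon> where "\<epsilon> = 3 * jacobi_eigenvalue \<alpha> k / real N"
  define \<mu> where "\<mu> = beta_sample \<alpha> N (poly p) 0"
  define Q where "Q = hahn_poly \<alpha> \<alpha> N k (real N * t)"
  have \<epsilon>: "\<epsilon> \<ge> 0" "\<epsilon> \<le> 1 / 2" using N eigenvalue_nonneg[OF \<alpha>, of k] by (simp_all add: \<epsilon>_def field_simps)
  have "\<bar>\<mu> - 1\<bar> \<le> \<epsilon>"
    using beta_sample_close[OF \<alpha> N(1), of 0 k] by (simp add: \<mu>_def p_def poly_jacobi01_0 \<epsilon>_def)
  hence \<mu>: "\<mu> \<ge> 1 / 2" "\<bar>1 - \<mu>\<bar> \<le> \<epsilon>" using \<epsilon> by linarith+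
  have Nt: "real N * t \<in> {0..real N}" using t N by (auto intro: mult_left_le)
  have "\<bar>\<mu> * Q - poly p t\<bar> \<le> \<epsilon>"
    using beta_sample_close[OF \<alpha> N(1) Nt, of k] beta_sample_jacobi[OF \<alpha> k Nt] N(1)
    by (simp add: Q_def \<mu>_def p_def \<epsilon>_def)
  moreover have "\<bar>poly p t\<bar> \<le> 1" using jacobi01_abs_le_1[OF \<alpha> t] by (simp add: p_def)
  ultimately have "\<bar>\<mu> * Q\<bar> \<le> 3 / 2" using \<epsilon> by linarith
  moreover have "1 / 2 * \<bar>Q\<bar> \<le> \<mu> * \<bar>Q\<bar>" using \<mu> by (intro mult_right_mono) auto
  ultimately have Q: "\<bar>Q\<bar> \<le> 3" using \<mu> by (simp add: abs_mult)
  have "\<bar>(1 - \<mu>) * Q\<bar> \<le> \<epsilon> * 3" using \<mu> Q \<epsilon> unfolding abs_mult by (intro mult_mono) auto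
  moreover have "Q - poly p t = (\<mu> * Q - poly p t) + (1 - \<mu>) * Q" by (simp add: algebra_simps)
  ultimately have "\<bar>Q - poly p t\<bar> \<le> 4 * \<epsilon>" using \<open>\<bar>\<mu> * Q - poly p t\<bar> \<le> \<epsilon>\<close> by linarith
  thus "\<bar>hahn_poly \<alpha> \<alpha> N k (real N * t) - poly (jacobi01 \<alpha> k) t\<bar> \<le> 12 * jacobi_eigenvalue \<alpha> k / real N"
    by (simp add: Q_def p_def \<epsilon>_def)
  show "beta_sample \<alpha> N (poly (jacobi01 \<alpha> k)) 0 > 0" using \<mu> by (simp add: \<mu>_def p_def)
  show "\<bar>hahn_poly \<alpha> \<alpha> N k (real N * t)\<bar> \<le> 3" using Q by (simp add: Q_def)
qed

text \<open>
  Numerator and denominator are both inner products with \<open>Q\<^sub>k = S p\<^sub>k / \<mu>\<^sub>k\<close>; duality moves them to the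
  interval with the same constant factor, and \<open>B Q\<^sub>k = p\<^sub>k\<close> identifies the denominator.
\<close>

lemma hahn_coefficient:
  assumes \<alpha>: "\<alpha> \<ge> 0" and k: "k \<le> N" and nz: "beta_sample \<alpha> N (poly (jacobi01 \<alpha> k)) 0 \<noteq> 0"
  shows "hahn_inner \<alpha> N g (\<lambda>i. hahn_poly \<alpha> \<alpha> N k (real i))
        / hahn_inner \<alpha> N (\<lambda>i. hahn_poly \<alpha> \<alpha> N k (real i)) (\<lambda>i. hahn_poly \<alpha> \<alpha> N k (real i))
    = jacobi01_inner \<alpha> (bernstein_op N g) (poly (jacobi01 \<alpha> k)) / jacobi01_inner \<alpha> (poly (jacobi01 \<alpha> k)) (poly (jacobi01 \<alpha> k))"
proof -
  define \<mu> where "\<mu> = beta_sample \<alpha> N (poly (jacobi01 \<alpha> k)) 0"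
  define Q where "Q = (\<lambda>i. hahn_poly \<alpha> \<alpha> N k (real i))"
  have "\<mu> * hahn_inner \<alpha> N g Q = hahn_scale \<alpha> N * jacobi01_inner \<alpha> (bernstein_op N g) (poly (jacobi01 \<alpha> k))" for g
  proof -
    have "hahn_scale \<alpha> N * jacobi01_inner \<alpha> (bernstein_op N g) (poly (jacobi01 \<alpha> k)) =
        hahn_inner \<alpha> N g (\<lambda>i. beta_sample \<alpha> N (poly (jacobi01 \<alpha> k)) (real i))"
      by (rule hahn_jacobi_duality[OF \<alpha> continuous_on_real_poly, symmetric])
    also have "\<dots> = hahn_inner \<alpha> N g (\<lambda>i. \<mu> * Q i)"
    proof -
      have "beta_sample \<alpha> N (poly (jacobi01 \<alpha> k)) (real i) = \<mu> * Q i" if "i \<le> N" for i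
        unfolding \<mu>_def Q_def using that by (intro beta_sample_jacobi[OF \<alpha> k]) auto
      thus ?thesis unfolding hahn_inner_def by (intro sum.cong refl) simp
    qed
    finally show ?thesis by (simp add: hahn_inner_def sum_distrib_left mult_ac)
  qed
  hence "hahn_inner \<alpha> N g Q = hahn_scale \<alpha> N / \<mu> * jacobi01_inner \<alpha> (bernstein_op N g) (poly (jacobi01 \<alpha> k))" for g
    using nz by (simp add: \<mu>_def field_simps)
  moreover have "hahn_scale \<alpha> N / \<mu> \<noteq> 0" using nz hahn_scale_pos[OF \<alpha>, of N] by (simp add: \<mu>_def)
  ultimately show ?thesis
    unfolding Q_def[symmetric] using bernstein_op_hahn[OF \<alpha> k] by (simp add: Q_def)
qed

section \<open>Bernstein approximation against a polynomial weight\<close>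

lemma BV_bound:
  assumes "f \<in> BV a b"
  obtains V where
    "\<And>n t. t 0 = a \<Longrightarrow> t n = b \<Longrightarrow> (\<And>i. i < n \<Longrightarrow> t i < t (Suc i)) \<Longrightarrow>
       (\<Sum>i<n. \<bar>f (t (Suc i)) - f (t i)\<bar>) \<le> V"
proof -
  have "total_variation f a b < \<infinity>" using assms by (simp add: BV_def)
  then obtain V :: nat where V: "total_variation f a b < ereal (real V)"
    using less_PInf_Ex_of_nat by auto
  show ?thesis
  proof (rule that)
    fix n and t :: "nat \<Rightarrow> real"
    assume "t 0 = a" "t n = b" "\<And>i. i < n \<Longrightarrow> t i < t (Suc i)"
    hence "ereal (\<Sum>i<n. \<bar>f (t (Suc i)) - f (t i)\<bar>) \<le> total_variation f a b"
      unfolding total_variation_def by (intro SUP_upper2[of "(n, t)"]) auto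
    thus "(\<Sum>i<n. \<bar>f (t (Suc i)) - f (t i)\<bar>) \<le> real V"
      using V by (metis ereal_less_eq(3) less_imp_le order_trans)
  qed
qed

lemma sum_pairs: "(\<Sum>j<2 * n. f j) = (\<Sum>m<n. f (2 * m) + f (Suc (2 * m)))" for f :: "nat \<Rightarrow> real"
  by (induction n) (simp_all add: add.assoc)

text \<open>
  Interleaving the grid points with one point \<open>\<xi> m\<close> from each open cell gives a single admissible
  partition; both sums are bounded by its variation sum.
\<close>

lemma variation_on_grid:
  fixes u :: "real \<Rightarrow> real"
  assumes V: "\<And>n t. t 0 = - 1 \<Longrightarrow> t n = 1 \<Longrightarrow> (\<And>i. i < n \<Longrightarrow> t i < t (Suc i)) \<Longrightarrow>
       (\<Sum>i<n. \<bar>u (t (Suc i)) - u (t i)\<bar>) \<le> V"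
    and v: "\<And>t. v t = u (2 * t - 1)"
    and N: "N > 0"
    and \<xi>: "\<And>m. m < N \<Longrightarrow> \<xi> m \<in> {real m / real N<..<real (Suc m) / real N}"
  shows "(\<Sum>m<N. \<bar>v (\<xi> m) - v (real m / real N)\<bar>) \<le> V"
    and "(\<Sum>m<N. \<bar>v (real (Suc m) / real N) - v (real m / real N)\<bar>) \<le> V"
proof -
  \<comment> \<open>even positions are grid points, odd positions the intermediate points, rescaled to \<open>[-1, 1]\<close>\<close>
  define T where "T = (\<lambda>j. 2 * (if even j then real (j div 2) / real N else \<xi> (j div 2)) - 1)"
  have "(\<Sum>j<2 * N. \<bar>u (T (Suc j)) - u (T j)\<bar>) \<le> V"
  proof (rule V)
    show "T 0 = - 1" "T (2 * N) = 1" using N by (simp_all add: T_def)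
    fix j assume j: "j < 2 * N"
    hence "\<xi> (j div 2) \<in> {real (j div 2) / real N<..<real (Suc (j div 2)) / real N}"
      by (intro \<xi>) auto
    thus "T j < T (Suc j)" by (auto simp: T_def)
  qed
  also have "(\<Sum>j<2 * N. \<bar>u (T (Suc j)) - u (T j)\<bar>) =
      (\<Sum>m<N. \<bar>v (\<xi> m) - v (real m / real N)\<bar> + \<bar>v (real (Suc m) / real N) - v (\<xi> m)\<bar>)"
    unfolding sum_pairs by (simp add: T_def v)
  finally have *: "(\<Sum>m<N. \<bar>v (\<xi> m) - v (real m / real N)\<bar> + \<bar>v (real (Suc m) / real N) - v (\<xi> m)\<bar>) \<le> V" .
  have "(\<Sum>m<N. \<bar>v (\<xi> m) - v (real m / real N)\<bar>) \<le>
      (\<Sum>m<N. \<bar>v (\<xi> m) - v (real m / real N)\<bar> + \<bar>v (real (Suc m) / real N) - v (\<xi> m)\<bar>)"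
    by (intro sum_mono) auto
  thus "(\<Sum>m<N. \<bar>v (\<xi> m) - v (real m / real N)\<bar>) \<le> V" using * by simp
  have "(\<Sum>m<N. \<bar>v (real (Suc m) / real N) - v (real m / real N)\<bar>) \<le>
      (\<Sum>m<N. \<bar>v (\<xi> m) - v (real m / real N)\<bar> + \<bar>v (real (Suc m) / real N) - v (\<xi> m)\<bar>)"
    by (intro sum_mono) linarith
  thus "(\<Sum>m<N. \<bar>v (real (Suc m) / real N) - v (real m / real N)\<bar>) \<le> V" using * by simp
qed

text \<open>
  The mean value theorem for integrals replaces the oscillation of \<open>v\<close> on the cell by its change up to one
  interior point, so that these changes can be summed within one partition.
\<close>

lemma cell_error:
  fixes v w :: "real \<Rightarrow> real"
  assumes ab: "a < b" and v: "continuous_on {a..b} v" and w: "continuous_on {a..b} w"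
    and w1: "\<And>t. t \<in> {a..b} \<Longrightarrow> \<bar>w t\<bar> \<le> 1"
  obtains \<xi> where "\<xi> \<in> {a<..<b}"
    "\<bar>integral {a..b} (\<lambda>t. v t * w t) - v a * integral {a..b} w\<bar> \<le> (b - a) * \<bar>v \<xi> - v a\<bar>"
proof -
  define g where "g = (\<lambda>t. \<bar>v t - v a\<bar>)"
  have g: "continuous_on {a..b} g" unfolding g_def using v by (intro continuous_intros)
  obtain \<xi> where \<xi>: "a < \<xi>" "\<xi> < b" "integral {a..b} g - integral {a..a} g = g \<xi> * (b - a)"
  proof (rule mvt[OF ab, where f = "\<lambda>x. integral {a..x} g" and f' = "\<lambda>x. (*) (g x)"])
    show "continuous_on {a..b} (\<lambda>x. integral {a..x} g)"
      by (rule indefinite_integral_continuous_1[OF integrable_continuous_real[OF g]])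
    fix x assume x: "a < x" "x < b"
    hence "((\<lambda>x. integral {a..x} g) has_real_derivative g x) (at x within {a..b})"
      by (intro integral_has_real_derivative g) auto
    hence "((\<lambda>x. integral {a..x} g) has_real_derivative g x) (at x)"
      using x by (simp add: at_within_Icc_at)
    thus "((\<lambda>x. integral {a..x} g) has_derivative (*) (g x)) (at x)"
      by (simp add: has_field_derivative_def)
  qed (use that in auto)
  have int: "(\<lambda>t. v t * w t) integrable_on {a..b}" "(\<lambda>t. v a * w t) integrable_on {a..b}"
    using v w by (auto intro!: integrable_continuous_real continuous_intros)
  have "integral {a..b} (\<lambda>t. v t * w t) - v a * integral {a..b} w =
      integral {a..b} (\<lambda>t. v t * w t - v a * w t)"
    by (simp add: integral_diff[OF int])
  also have "\<bar>\<dots>\<bar> \<le> integral {a..b} g"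
  proof (rule integral_norm_bound_integral[where f = "\<lambda>t. v t * w t - v a * w t", simplified real_norm_def])
    show "(\<lambda>t. v t * w t - v a * w t) integrable_on {a..b}" using int by (rule integrable_diff)
    show "g integrable_on {a..b}" by (rule integrable_continuous_real[OF g])
    fix t assume "t \<in> {a..b}"
    hence "\<bar>v t - v a\<bar> * \<bar>w t\<bar> \<le> \<bar>v t - v a\<bar> * 1" by (intro mult_left_mono w1) auto
    thus "\<bar>v t * w t - v a * w t\<bar> \<le> g t"
      by (simp add: g_def abs_mult[symmetric] left_diff_distrib)
  qed
  also have "integral {a..b} g = (b - a) * g \<xi>" using \<xi>(3) by simp
  finally show ?thesis using that \<xi> by (simp add: g_def)
qed

text \<open>
  The derivative of the Bernstein operator of order \<open>M + 1\<close> is the operator of order \<open>M\<close> applied to the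
  difference quotients of \<open>g\<close>.
\<close>

lemma bernstein_op_derivative:
  "(bernstein_op (Suc M) g has_real_derivative
      (\<Sum>m\<le>M. (g (Suc m) - g m) * (real (Suc M) * Bernstein M m t))) (at t)"
proof -
  \<comment> \<open>\<open>R i\<close> stands for the Bernstein polynomial with index \<open>i - 1\<close>, which is \<open>0\<close> when \<open>i = 0\<close>\<close>
  define R where "R = (\<lambda>i. case i of 0 \<Rightarrow> 0 | Suc m \<Rightarrow> Bernstein M m t)"
  have B': "((\<lambda>t. Bernstein (Suc M) i t) has_real_derivative real (Suc M) * (R i - Bernstein M i t)) (at t)"
    if "i \<le> Suc M" for i
  proof -
    define D where "D = real (Suc M choose i) * (real i * t ^ (i - 1) * (1 - t) ^ (Suc M - i)
        - real (Suc M - i) * (1 - t) ^ (Suc M - i - 1) * t ^ i)"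
    have "((\<lambda>t. Bernstein (Suc M) i t) has_real_derivative D) (at t)"
      unfolding Bernstein_def D_def by (auto intro!: derivative_eq_intros simp: algebra_simps simp del: binomial_Suc_Suc)
    moreover have "real (Suc M choose i) * (real i * t ^ (i - 1) * (1 - t) ^ (Suc M - i)) = real (Suc M) * R i"
    proof (cases i)
      case (Suc m)
      have "real (Suc m) * real (Suc M choose Suc m) = real (Suc M) * real (M choose m)"
        unfolding of_nat_mult[symmetric] by (subst Suc_times_binomial) simp
      thus ?thesis by (simp add: R_def Suc Bernstein_def mult_ac del: of_nat_Suc binomial_Suc_Suc)
    qed (simp add: R_def)
    moreover have "real (Suc M choose i) * (real (Suc M - i) * (1 - t) ^ (Suc M - i - 1) * t ^ i) =
        real (Suc M) * Bernstein M i t"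
    proof -
      have "(Suc M - i) * (Suc M choose i) = Suc M * (M choose i)"
        using binomial_absorb_comp[of "Suc M" i] by simp
      hence "real (Suc M - i) * real (Suc M choose i) = real (Suc M) * real (M choose i)"
        unfolding of_nat_mult[symmetric] by simp
      thus ?thesis
        by (simp add: Bernstein_def mult_ac del: of_nat_Suc binomial_Suc_Suc)
    qed
    ultimately show ?thesis by (simp add: D_def right_diff_distrib)
  qed
  have "(bernstein_op (Suc M) g has_real_derivative
      (\<Sum>i\<le>Suc M. g i * (real (Suc M) * (R i - Bernstein M i t)))) (at t)"
    unfolding bernstein_op_def by (intro DERIV_sum DERIV_cmult B') auto
  also have "(\<Sum>i\<le>Suc M. g i * (real (Suc M) * (R i - Bernstein M i t))) =
      (\<Sum>i\<le>Suc M. g i * (real (Suc M) * R i)) - (\<Sum>i\<le>Suc M. g i * (real (Suc M) * Bernstein M i t))"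
    by (simp only: right_diff_distrib sum_subtractf)
  also have "(\<Sum>i\<le>Suc M. g i * (real (Suc M) * R i)) = (\<Sum>m\<le>M. g (Suc m) * (real (Suc M) * Bernstein M m t))"
    by (subst sum.atMost_Suc_shift) (simp add: R_def)
  also have "(\<Sum>i\<le>Suc M. g i * (real (Suc M) * Bernstein M i t)) = (\<Sum>m\<le>M. g m * (real (Suc M) * Bernstein M m t))"
    by (simp add: Bernstein_def)
  finally show ?thesis by (simp only: left_diff_distrib sum_subtractf)
qed

lemma Bernstein_beta_mean:
  assumes "m \<le> M"
  shows "integral {0..1} (\<lambda>t. F t * (real (Suc M) * Bernstein M m t)) = beta_mean (real m) (real (M - m)) F"
proof -
  have "Beta (real m + 1) (real (M - m) + 1) = fact m * fact (M - m) / fact (Suc M)"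
  proof -
    have "real m + 1 + (real (M - m) + 1) = 1 + real (Suc M)" using assms by simp
    thus ?thesis using Gamma_fact[of m, where 'a = real] Gamma_fact[of "M - m", where 'a = real]
        Gamma_fact[of "Suc M", where 'a = real]
      unfolding Beta_def by (simp only: add.commute)
  qed
  also have "\<dots> = 1 / (real (Suc M) * real (M choose m))"
    using binomial_fact[OF assms, where 'a = real] by simp
  finally have Beta: "Beta (real m + 1) (real (M - m) + 1) = 1 / (real (Suc M) * real (M choose m))" .
  have "integral {0..1} (\<lambda>t. F t * (real (Suc M) * Bernstein M m t)) =
      integral {0..1} (\<lambda>t. real (Suc M) * real (M choose m) * (F t * beta_weight (real m) (real (M - m)) t))"
    by (intro integral_cong) (simp add: Bernstein_def beta_weight_of_nat)
  also have "\<dots> = real (Suc M) * real (M choose m) * integral {0..1} (\<lambda>t. F t * beta_weight (real m) (real (M - m)) t)"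
    by simp
  finally show ?thesis
    unfolding beta_mean_def Beta by simp
qed

text \<open>
  In this context \<open>F\<close> is the primitive of \<open>w p\<close>. Integration by parts throws the derivative onto \<open>B v\<close>, and
  what has to be compared is \<open>F\<close> at grid points with Beta means of \<open>F\<close>.
\<close>

context
  fixes \<alpha> D :: real and p :: "real poly" and F :: "real \<Rightarrow> real"
  assumes \<alpha>: "\<alpha> \<ge> 0"
    and p1: "\<And>t. t \<in> {0..1} \<Longrightarrow> \<bar>poly p t\<bar> \<le> 1"
    and pD: "\<And>t. t \<in> {0..1} \<Longrightarrow> t * (1 - t) * \<bar>poly (pderiv p) t\<bar> \<le> D"
  defines "F \<equiv> (\<lambda>x. integral {0..x} (\<lambda>t. poly p t * beta_weight \<alpha> \<alpha> t))"
begin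

private lemma cont: "continuous_on {0..1} (\<lambda>t. poly p t * beta_weight \<alpha> \<alpha> t)"
  using \<alpha> by (intro continuous_intros) auto

private lemma integrand_le_1: "t \<in> {0..1} \<Longrightarrow> \<bar>poly p t * beta_weight \<alpha> \<alpha> t\<bar> \<le> 1"
  unfolding abs_mult using p1[of t] beta_weight_le_1[of \<alpha> \<alpha> t] beta_weight_nonneg[of t \<alpha> \<alpha>] \<alpha>
  by (intro mult_le_one) auto

private lemma F_deriv:
  "x \<in> {0..1} \<Longrightarrow> (F has_real_derivative poly p x * beta_weight \<alpha> \<alpha> x) (at x within {0..1})"
  unfolding F_def by (rule integral_has_real_derivative[OF cont])

private lemma F_cont: "continuous_on {0..1} F"
  unfolding F_def by (rule indefinite_integral_continuous_1[OF integrable_continuous_real[OF cont]])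

private lemma F_deriv_at:
  "x \<in> {0<..<1} \<Longrightarrow> (F has_real_derivative poly p x * beta_weight \<alpha> \<alpha> x) (at x)"
  using F_deriv[of x] at_within_Icc_at[of 0 x 1] by simp

private lemma F_lipschitz:
  assumes "x \<in> {0..1}" "y \<in> {0..1}"
  shows "\<bar>F x - F y\<bar> \<le> \<bar>x - y\<bar>"
proof -
  have "norm (F x - F y) \<le> 1 * norm (x - y)"
    by (rule field_differentiable_bound[of "{0..1}" _ "\<lambda>x. poly p x * beta_weight \<alpha> \<alpha> x"])
       (use assms F_deriv integrand_le_1 in auto)
  thus ?thesis by simp
qed

text \<open>
  Here \<open>t (1 - t) F'' = w (t (1 - t) p' + \<alpha> (1 - 2 t) p)\<close>: the factor \<open>t (1 - t)\<close> cancels the singularity of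
  the derivative of \<open>w\<close>.
\<close>

private lemma F_mean:
  assumes "a \<ge> 0" "b \<ge> 0"
  shows "\<bar>beta_mean a b F - F ((a + 1) / (a + b + 2))\<bar> \<le> (\<alpha> + D) / (a + b + 3)"
proof (rule beta_mean_error[OF assms F_cont])
  fix s :: real assume s: "s \<in> {0<..<1}"
  define w where "w = beta_weight \<alpha> \<alpha> s"
  show "(F has_real_derivative poly p s * beta_weight \<alpha> \<alpha> s) (at s)" by (rule F_deriv_at[OF s])
  show "((\<lambda>s. poly p s * beta_weight \<alpha> \<alpha> s) has_real_derivative
      (poly (pderiv p) s * beta_weight \<alpha> \<alpha> s + beta_weight \<alpha> \<alpha> s * (\<alpha> / s - \<alpha> / (1 - s)) * poly p s)) (at s)"
    using s by (intro DERIV_mult poly_DERIV beta_weight_derivative) auto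
  have w: "0 \<le> w" "w \<le> 1"
    using s \<alpha> by (auto simp: w_def intro!: beta_weight_nonneg beta_weight_le_1)
  have "s * (1 - s) * \<bar>poly (pderiv p) s * w + w * (\<alpha> / s - \<alpha> / (1 - s)) * poly p s\<bar> =
      \<bar>s * (1 - s) * (poly (pderiv p) s * w + w * (\<alpha> / s - \<alpha> / (1 - s)) * poly p s)\<bar>"
    using s by (simp add: abs_mult)
  also have "s * (1 - s) * (poly (pderiv p) s * w + w * (\<alpha> / s - \<alpha> / (1 - s)) * poly p s) =
      w * (s * (1 - s) * poly (pderiv p) s) + w * (\<alpha> * ((1 - 2 * s) * poly p s))"
  proof -
    have "s * (1 - s) * (\<alpha> / s - \<alpha> / (1 - s)) = \<alpha> * (1 - 2 * s)"
      using s by (simp add: field_simps)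
    thus ?thesis by algebra
  qed
  also have "\<bar>\<dots>\<bar> \<le> \<bar>w * (s * (1 - s) * poly (pderiv p) s)\<bar> + \<bar>w * (\<alpha> * ((1 - 2 * s) * poly p s))\<bar>"
    by (rule abs_triangle_ineq)
  also have "\<bar>w * (s * (1 - s) * poly (pderiv p) s)\<bar> \<le> 1 * D"
    using s w pD[of s] by (simp only: abs_mult) (intro mult_mono, auto)
  also have "\<bar>w * (\<alpha> * ((1 - 2 * s) * poly p s))\<bar> \<le> 1 * (\<alpha> * (1 * 1))"
    using s w \<alpha> p1[of s] unfolding abs_mult by (intro mult_mono) auto
  finally show "s * (1 - s) * \<bar>poly (pderiv p) s * beta_weight \<alpha> \<alpha> s +
      beta_weight \<alpha> \<alpha> s * (\<alpha> / s - \<alpha> / (1 - s)) * poly p s\<bar> \<le> \<alpha> + D"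
    by (simp add: w_def)
qed

private lemma bernstein_by_parts:
  "jacobi01_inner \<alpha> (bernstein_op (Suc M) g) (poly p) =
     g (Suc M) * F 1 - (\<Sum>m\<le>M. (g (Suc m) - g m) * beta_mean (real m) (real (M - m)) F)"
proof -
  define B' where "B' = (\<lambda>t. \<Sum>m\<le>M. (g (Suc m) - g m) * (real (Suc M) * Bernstein M m t))"
  have ends: "bernstein_op (Suc M) g 1 = g (Suc M)" "F 0 = 0"
  proof -
    have "bernstein_op (Suc M) g 1 = (\<Sum>i\<le>Suc M. if i = Suc M then g i else 0)"
      unfolding bernstein_op_def by (intro sum.cong refl) (auto simp: Bernstein_def)
    thus "bernstein_op (Suc M) g 1 = g (Suc M)" by simp
  qed (simp add: F_def)
  have cont_B': "continuous_on {0..1} B'"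
    unfolding B'_def Bernstein_def by (intro continuous_intros)
  have "((\<lambda>t. B' t * F t + (poly p t * beta_weight \<alpha> \<alpha> t) * bernstein_op (Suc M) g t) has_integral
      (bernstein_op (Suc M) g 1 * F 1 - bernstein_op (Suc M) g 0 * F 0)) {0..1}"
  proof (rule fundamental_theorem_of_calculus_interior)
    show "continuous_on {0..1} (\<lambda>t. bernstein_op (Suc M) g t * F t)"
      by (intro continuous_intros F_cont)
    fix t :: real assume t: "t \<in> {0<..<1}"
    show "((\<lambda>t. bernstein_op (Suc M) g t * F t) has_vector_derivative
        B' t * F t + (poly p t * beta_weight \<alpha> \<alpha> t) * bernstein_op (Suc M) g t) (at t)"
      unfolding has_real_derivative_iff_has_vector_derivative[symmetric] B'_def
      by (intro DERIV_mult bernstein_op_derivative F_deriv_at t)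
  qed simp
  hence "g (Suc M) * F 1 = integral {0..1} (\<lambda>t. B' t * F t + (poly p t * beta_weight \<alpha> \<alpha> t) * bernstein_op (Suc M) g t)"
    by (simp add: integral_unique ends)
  also have "\<dots> = integral {0..1} (\<lambda>t. B' t * F t)
      + integral {0..1} (\<lambda>t. (poly p t * beta_weight \<alpha> \<alpha> t) * bernstein_op (Suc M) g t)"
    by (intro integral_add integrable_continuous_real continuous_on_mult cont cont_B' F_cont
        continuous_on_bernstein_op)
  also have "integral {0..1} (\<lambda>t. (poly p t * beta_weight \<alpha> \<alpha> t) * bernstein_op (Suc M) g t) =
      jacobi01_inner \<alpha> (bernstein_op (Suc M) g) (poly p)"
    by (simp add: jacobi01_inner_def mult_ac)
  also have "integral {0..1} (\<lambda>t. B' t * F t) =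
      integral {0..1} (\<lambda>t. \<Sum>m\<le>M. (g (Suc m) - g m) * (F t * (real (Suc M) * Bernstein M m t)))"
    by (simp add: B'_def sum_distrib_left sum_distrib_right mult_ac)
  also have "\<dots> = (\<Sum>m\<le>M. integral {0..1} (\<lambda>t. (g (Suc m) - g m) * (F t * (real (Suc M) * Bernstein M m t))))"
    unfolding Bernstein_def by (intro integral_sum integrable_continuous_real continuous_intros F_cont) auto
  also have "\<dots> = (\<Sum>m\<le>M. (g (Suc m) - g m) * beta_mean (real m) (real (M - m)) F)"
    by (intro sum.cong refl) (simp add: Bernstein_beta_mean del: of_nat_Suc)
  finally show ?thesis by simp
qed

text \<open>
  Summation by parts on the grid writes \<open>(v, p)\<close>, up to \<open>V / N\<close>, as \<open>v(1) F(1)\<close> minus the sum of the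
  increments of \<open>v\<close> weighted by \<open>F\<close> at the grid points; \<open>bernstein_by_parts\<close> writes \<open>(B v, p)\<close> in the same
  form with Beta means of \<open>F\<close> as weights. The mean of the \<open>m\<close>-th density is \<open>(m + 1) / (N + 1)\<close>, within
  \<open>1 / N\<close> of the grid point \<open>(m + 1) / N\<close>.
\<close>

lemma bernstein_quadrature:
  fixes u v :: "real \<Rightarrow> real"
  assumes V: "\<And>n t. t 0 = - 1 \<Longrightarrow> t n = 1 \<Longrightarrow> (\<And>i. i < n \<Longrightarrow> t i < t (Suc i)) \<Longrightarrow>
       (\<Sum>i<n. \<bar>u (t (Suc i)) - u (t i)\<bar>) \<le> V"
    and v: "\<And>t. v t = u (2 * t - 1)"
    and N: "N > 0"
    and v_cont: "continuous_on {0..1} v"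
  shows "\<bar>jacobi01_inner \<alpha> (bernstein_op N (\<lambda>i. v (real i / real N))) (poly p) - jacobi01_inner \<alpha> v (poly p)\<bar>
    \<le> V * (\<alpha> + D + 2) / real N"
proof -
  define q where "q = (\<lambda>t. poly p t * beta_weight \<alpha> \<alpha> t)"
  define x where "x = (\<lambda>m. real m / real N)"
  obtain M where M: "N = Suc M" using N by (cases N) auto
  have x01: "x m \<in> {0..1}" if "m \<le> N" for m using that N by (auto simp: x_def)
  have x_less: "x m < x (Suc m)" for m using N by (simp add: x_def divide_strict_right_mono)
  have x_ends: "x 0 = 0" "x N = 1" using N by (simp_all add: x_def)
  have sub: "{x m..x (Suc m)} \<subseteq> {0..1}" if "m < N" for m
    using x01[of m] x01[of "Suc m"] that by auto
  have q_cont: "continuous_on {0..1} q" unfolding q_def by (rule cont)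
  have vq: "continuous_on {0..1} (\<lambda>t. v t * q t)" using v_cont q_cont by (intro continuous_intros)
  have split: "integral {0..x n} f = (\<Sum>m<n. integral {x m..x (Suc m)} f)"
    if "continuous_on {0..1} f" "n \<le> N" for f :: "real \<Rightarrow> real" and n
    using that(2)
  proof (induction n)
    case (Suc n)
    have "integral {0..x n} f + integral {x n..x (Suc n)} f = integral {0..x (Suc n)} f"
    proof (rule Henstock_Kurzweil_Integration.integral_combine)
      show "f integrable_on {0..x (Suc n)}"
        by (rule integrable_continuous_real[OF continuous_on_subset[OF that(1)]])
           (use x01[of "Suc n"] Suc.prems in auto)
    qed (use x01[of n] x_less[of n] Suc.prems in auto)
    thus ?case using Suc by simp
  qed (simp add: x_ends)
  have F_diff: "integral {x m..x (Suc m)} q = F (x (Suc m)) - F (x m)" if "m < N" for m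
    using split[OF q_cont, of m] split[OF q_cont, of "Suc m"] that by (simp add: F_def q_def)
  define good where "good = (\<lambda>m \<xi>. \<xi> \<in> {x m<..<x (Suc m)} \<and>
      \<bar>integral {x m..x (Suc m)} (\<lambda>t. v t * q t) - v (x m) * integral {x m..x (Suc m)} q\<bar>
        \<le> (x (Suc m) - x m) * \<bar>v \<xi> - v (x m)\<bar>)"
  define \<xi> where "\<xi> = (\<lambda>m. SOME s. good m s)"
  have "good m (\<xi> m)" if "m < N" for m
  proof -
    have q1: "\<bar>q t\<bar> \<le> 1" if "t \<in> {x m..x (Suc m)}" for t
      unfolding q_def using that sub[OF \<open>m < N\<close>] by (intro integrand_le_1) blast
    obtain s where "good m s"
      unfolding good_def
      by (rule cell_error[OF x_less[of m] continuous_on_subset[OF v_cont sub[OF \<open>m < N\<close>]]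
          continuous_on_subset[OF q_cont sub[OF \<open>m < N\<close>]] q1]) blast+
    thus ?thesis unfolding \<xi>_def by (rule someI)
  qed
  hence \<xi>: "\<And>m. m < N \<Longrightarrow> \<xi> m \<in> {x m<..<x (Suc m)}"
    "\<And>m. m < N \<Longrightarrow> \<bar>integral {x m..x (Suc m)} (\<lambda>t. v t * q t) - v (x m) * integral {x m..x (Suc m)} q\<bar>
        \<le> (x (Suc m) - x m) * \<bar>v (\<xi> m) - v (x m)\<bar>"
    by (simp_all add: good_def)
  have width: "x (Suc m) - x m = 1 / real N" for m
    by (simp add: x_def diff_divide_distrib[symmetric])
  have \<xi>_cell: "\<xi> m \<in> {real m / real N<..<real (Suc m) / real N}" if "m < N" for m
    using \<xi>(1)[OF that] unfolding x_def .
  have var\<^sub>1: "(\<Sum>m<N. \<bar>v (\<xi> m) - v (x m)\<bar>) \<le> V"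
    unfolding x_def by (rule variation_on_grid(1)[where u = u]; fact V v N \<xi>_cell)
  have var\<^sub>2: "(\<Sum>m<N. \<bar>v (x (Suc m)) - v (x m)\<bar>) \<le> V"
    unfolding x_def by (rule variation_on_grid(2)[where u = u and \<xi> = \<xi>]; fact V v N \<xi>_cell)+
  have "\<bar>jacobi01_inner \<alpha> v (poly p) - (\<Sum>m<N. v (x m) * (F (x (Suc m)) - F (x m)))\<bar> \<le> V / real N"
  proof -
    have "jacobi01_inner \<alpha> v (poly p) = (\<Sum>m<N. integral {x m..x (Suc m)} (\<lambda>t. v t * q t))"
      using split[OF vq, of N] by (simp add: x_ends jacobi01_inner_def q_def mult_ac)
    hence "\<bar>jacobi01_inner \<alpha> v (poly p) - (\<Sum>m<N. v (x m) * (F (x (Suc m)) - F (x m)))\<bar> =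
        \<bar>\<Sum>m<N. integral {x m..x (Suc m)} (\<lambda>t. v t * q t) - v (x m) * integral {x m..x (Suc m)} q\<bar>"
      by (simp add: sum_subtractf F_diff)
    also have "\<dots> \<le> (\<Sum>m<N. (x (Suc m) - x m) * \<bar>v (\<xi> m) - v (x m)\<bar>)"
      by (intro order.trans[OF sum_abs] sum_mono \<xi>(2)) auto
    also have "\<dots> = (\<Sum>m<N. \<bar>v (\<xi> m) - v (x m)\<bar>) / real N"
      unfolding width by (simp add: sum_divide_distrib)
    also have "\<dots> \<le> V / real N" by (intro divide_right_mono var\<^sub>1) auto
    finally show ?thesis .
  qed
  moreover have "(\<Sum>m<N. v (x m) * (F (x (Suc m)) - F (x m))) =
      v 1 * F 1 - (\<Sum>m<N. (v (x (Suc m)) - v (x m)) * F (x (Suc m)))"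
  proof -
    have "(\<Sum>m<N. v (x m) * (F (x (Suc m)) - F (x m))) + (\<Sum>m<N. (v (x (Suc m)) - v (x m)) * F (x (Suc m)))
        = (\<Sum>m<N. v (x (Suc m)) * F (x (Suc m)) - v (x m) * F (x m))"
      unfolding sum.distrib[symmetric] by (intro sum.cong refl) (simp add: algebra_simps)
    also have "\<dots> = v 1 * F 1 - v 0 * F 0"
      using sum_lessThan_telescope[of "\<lambda>m. v (x m) * F (x m)" N] by (simp add: x_ends)
    also have "F 0 = 0" by (simp add: F_def)
    finally show ?thesis by simp
  qed
  moreover have "jacobi01_inner \<alpha> (bernstein_op N (\<lambda>i. v (real i / real N))) (poly p) =
      v 1 * F 1 - (\<Sum>m<N. (v (x (Suc m)) - v (x m)) * beta_mean (real m) (real (M - m)) F)"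
    using bernstein_by_parts[of M "\<lambda>i. v (x i)"] x_ends
    by (simp add: M x_def lessThan_Suc_atMost del: of_nat_Suc)
  moreover have "\<bar>(\<Sum>m<N. (v (x (Suc m)) - v (x m)) * F (x (Suc m)))
      - (\<Sum>m<N. (v (x (Suc m)) - v (x m)) * beta_mean (real m) (real (M - m)) F)\<bar> \<le> V * (\<alpha> + D + 1) / real N"
  proof -
    have mean: "\<bar>F (x (Suc m)) - beta_mean (real m) (real (M - m)) F\<bar> \<le> (\<alpha> + D + 1) / real N" if m: "m < N" for m
    proof -
      have eqs: "real m + real (M - m) + 2 = real N + 1" "real m + real (M - m) + 3 = real N + 2"
        using m by (simp_all add: M)
      have D: "D \<ge> 0" using pD[of 0] by simp
      have "\<bar>beta_mean (real m) (real (M - m)) F - F ((real m + 1) / (real N + 1))\<bar> \<le> (\<alpha> + D) / (real N + 2)"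
        using F_mean[of "real m" "real (M - m)"] unfolding eqs by simp
      also have "\<dots> \<le> (\<alpha> + D) / real N" using \<alpha> D N by (intro divide_left_mono) auto
      finally have 1: "\<bar>beta_mean (real m) (real (M - m)) F - F ((real m + 1) / (real N + 1))\<bar> \<le> (\<alpha> + D) / real N" .
      have "\<bar>F (x (Suc m)) - F ((real m + 1) / (real N + 1))\<bar> \<le> \<bar>x (Suc m) - (real m + 1) / (real N + 1)\<bar>"
        using m x01[of "Suc m"] by (intro F_lipschitz) auto
      also have "x (Suc m) - (real m + 1) / (real N + 1) = x (Suc m) / (real N + 1)"
        using N by (simp add: x_def field_simps)
      also have "\<bar>\<dots>\<bar> \<le> 1 / real N"
        using x01[of "Suc m"] m N by (auto intro!: frac_le)
      finally have "\<bar>F (x (Suc m)) - F ((real m + 1) / (real N + 1))\<bar> \<le> 1 / real N" .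
      with 1 show ?thesis by (simp add: add_divide_distrib)
    qed
    have "\<bar>(\<Sum>m<N. (v (x (Suc m)) - v (x m)) * F (x (Suc m)))
        - (\<Sum>m<N. (v (x (Suc m)) - v (x m)) * beta_mean (real m) (real (M - m)) F)\<bar> =
        \<bar>\<Sum>m<N. (v (x (Suc m)) - v (x m)) * (F (x (Suc m)) - beta_mean (real m) (real (M - m)) F)\<bar>"
      by (simp add: sum_subtractf right_diff_distrib)
    also have "\<dots> \<le> (\<Sum>m<N. \<bar>v (x (Suc m)) - v (x m)\<bar> * ((\<alpha> + D + 1) / real N))"
      by (intro order.trans[OF sum_abs] sum_mono, unfold abs_mult, intro mult_left_mono mean) auto
    also have "\<dots> = (\<Sum>m<N. \<bar>v (x (Suc m)) - v (x m)\<bar>) * ((\<alpha> + D + 1) / real N)"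
      by (rule sum_distrib_right[symmetric])
    also have "\<dots> \<le> V * ((\<alpha> + D + 1) / real N)"
      using var\<^sub>2 \<alpha> pD[of 0] by (intro mult_right_mono divide_nonneg_nonneg) auto
    finally show ?thesis by simp
  qed
  moreover have "V * (\<alpha> + D + 2) / real N = V * (\<alpha> + D + 1) / real N + V / real N"
    by (simp add: add_divide_distrib[symmetric] algebra_simps)
  ultimately show ?thesis by linarith
qed

end

section \<open>Transfer to the unit interval\<close>

lemma jacobi_inner_eq_jacobi01_inner:
  assumes "\<alpha> \<ge> 0" "continuous_on {0..1} (\<lambda>t. f (2 * t - 1))" "continuous_on {0..1} (\<lambda>t. g (2 * t - 1))"
  shows "jacobi_inner \<alpha> f g = 2 * 4 powr \<alpha> * jacobi01_inner \<alpha> (\<lambda>t. f (2 * t - 1)) (\<lambda>t. g (2 * t - 1))"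
proof -
  define h where "h = (\<lambda>t. f (2 * t - 1) * g (2 * t - 1) * beta_weight \<alpha> \<alpha> t)"
  have "(h has_integral integral {0..1} h) (cbox 0 1)"
    unfolding h_def using assms
    by (auto intro!: integrable_integral integrable_continuous_real continuous_intros)
  from has_integral_affinity'[OF this, of "1 / 2" "1 / 2"]
  have "((\<lambda>x. h (1 / 2 * x + 1 / 2)) has_integral 2 * integral {0..1} h) {- 1..1}"
    by (simp add: mult.commute)
  hence int: "((\<lambda>x. 4 powr \<alpha> * h (1 / 2 * x + 1 / 2)) has_integral 4 powr \<alpha> * (2 * integral {0..1} h)) {- 1..1}"
    by (rule has_integral_mult_right)
  have "((\<lambda>x. f x * g x * jacobi_weight \<alpha> x) has_integral 4 powr \<alpha> * (2 * integral {0..1} h)) {- 1..1}"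
  proof (rule has_integral_spike_finite[where S = "{- 1, 1}", OF _ _ int])
    fix x :: real assume "x \<in> {- 1..1} - {- 1, 1}"
    hence x: "- 1 < x" "x < 1" by auto
    define t where "t = 1 / 2 * x + 1 / 2"
    have t: "0 < t" "t < 1" "x = 2 * t - 1" using x by (auto simp: t_def)
    have "jacobi_weight \<alpha> x = (2 * (1 - t)) powr \<alpha> * (2 * t) powr \<alpha>"
      unfolding jacobi_weight_def t(3) by (simp add: algebra_simps)
    also have "\<dots> = (2 * 2) powr \<alpha> * beta_weight \<alpha> \<alpha> t"
      using t by (simp only: powr_mult beta_weight_def cpow_eq_powr) (simp add: cpow_eq_powr mult_ac)
    finally have "jacobi_weight \<alpha> x = 4 powr \<alpha> * beta_weight \<alpha> \<alpha> t" by simp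
    thus "f x * g x * jacobi_weight \<alpha> x = 4 powr \<alpha> * h (1 / 2 * x + 1 / 2)"
      unfolding t_def[symmetric] h_def t(3)[symmetric] by (simp add: mult_ac)
  qed simp
  thus ?thesis
    by (simp add: jacobi_inner_def jacobi01_inner_def h_def integral_unique)
qed

text \<open>
  The standard form expands in \<open>(1 - x) / 2\<close>, the Hahn polynomials in \<open>y / N = (1 + x) / 2\<close>. The reflection
  symmetry reconciles the two.
\<close>

lemma jacobi_poly_eq_jacobi01:
  assumes "\<alpha> \<ge> 0"
  obtains c where "c \<noteq> 0" "\<And>x. jacobi_poly \<alpha> \<alpha> k x = c * poly (jacobi01 \<alpha> k) ((1 + x) / 2)"
proof -
  obtain \<sigma> where \<sigma>: "\<bar>\<sigma>\<bar> = 1" "\<And>t. poly (jacobi01 \<alpha> k) (1 - t) = \<sigma> * poly (jacobi01 \<alpha> k) t"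
    using jacobi01_reflect[OF assms] by metis
  define b where "b = gamma_binomial (real k + \<alpha>) (real k)"
  have "Gamma (real k + \<alpha> + 1) > 0" "Gamma (real k + 1) > (0::real)" "Gamma (real k + \<alpha> - real k + 1) > 0"
    using assms by (auto intro!: Gamma_real_pos simp del: Gamma_eq_zero_iff)
  hence "b > 0" unfolding b_def gamma_binomial_def by (intro divide_pos_pos mult_pos_pos)
  have "jacobi_poly \<alpha> \<alpha> k x = b * \<sigma> * poly (jacobi01 \<alpha> k) ((1 + x) / 2)" for x
  proof -
    have "real k + \<alpha> + \<alpha> + 1 = real k + 2 * \<alpha> + 1" by simp
    hence "jacobi_poly \<alpha> \<alpha> k x = b * poly (jacobi01 \<alpha> k) ((1 - x) / 2)"
      unfolding jacobi_poly_def b_def jacobi01_def jacobi_coeff_def poly_sum poly_monom by (simp only:)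
    also have "(1 - x) / 2 = 1 - (1 + x) / 2" by (simp add: field_simps)
    finally show ?thesis by (simp only: \<sigma>(2) mult.assoc)
  qed
  moreover have "b * \<sigma> \<noteq> 0" using \<open>b > 0\<close> \<sigma>(1) by auto
  ultimately show ?thesis using that by blast
qed

lemma jacobi_sum_eq:
  assumes \<alpha>: "\<alpha> \<ge> 0" and u: "continuous_on {0..1} (\<lambda>t. u (2 * t - 1))"
  shows "jacobi_sum \<alpha> u n x = (\<Sum>k\<le>n. jacobi01_inner \<alpha> (\<lambda>t. u (2 * t - 1)) (poly (jacobi01 \<alpha> k))
      / jacobi01_inner \<alpha> (poly (jacobi01 \<alpha> k)) (poly (jacobi01 \<alpha> k)) * poly (jacobi01 \<alpha> k) ((1 + x) / 2))"
  unfolding jacobi_sum_def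
proof (intro sum.cong refl)
  fix k
  obtain c where c: "c \<noteq> 0" "\<And>x. jacobi_poly \<alpha> \<alpha> k x = c * poly (jacobi01 \<alpha> k) ((1 + x) / 2)"
    using jacobi_poly_eq_jacobi01[OF \<alpha>] by metis
  have P: "(\<lambda>t. jacobi_poly \<alpha> \<alpha> k (2 * t - 1)) = poly (smult c (jacobi01 \<alpha> k))"
    by (simp add: c(2) fun_eq_iff)
  have P_cont: "continuous_on {0..1} (\<lambda>t. jacobi_poly \<alpha> \<alpha> k (2 * t - 1))"
    unfolding P by (rule continuous_on_real_poly)
  have "(4::real) powr \<alpha> \<noteq> 0" by simp
  thus "jacobi_inner \<alpha> u (jacobi_poly \<alpha> \<alpha> k) / jacobi_inner \<alpha> (jacobi_poly \<alpha> \<alpha> k) (jacobi_poly \<alpha> \<alpha> k)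
      * jacobi_poly \<alpha> \<alpha> k x =
    jacobi01_inner \<alpha> (\<lambda>t. u (2 * t - 1)) (poly (jacobi01 \<alpha> k))
      / jacobi01_inner \<alpha> (poly (jacobi01 \<alpha> k)) (poly (jacobi01 \<alpha> k)) * poly (jacobi01 \<alpha> k) ((1 + x) / 2)"
    unfolding jacobi_inner_eq_jacobi01_inner[OF \<alpha> u P_cont] jacobi_inner_eq_jacobi01_inner[OF \<alpha> P_cont P_cont] P
      jacobi01_inner_poly_linear[OF \<alpha>] c(2)[of x]
    using c(1) jacobi01_norm_pos[OF \<alpha>, of k] by (simp add: field_simps)
qed

text \<open>
  Cauchy-Schwarz, obtained from \<open>|v p| \<le> (s M\<^sup>2 + p\<^sup>2 / s) / 2\<close> with the optimal \<open>s = \<surd>h\<^sub>k / M\<close>.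
\<close>

lemma jacobi01_inner_jacobi_bound:
  assumes \<alpha>: "\<alpha> \<ge> 0" and v: "continuous_on {0..1} v" and M: "M > 0" "\<And>t. t \<in> {0..1} \<Longrightarrow> \<bar>v t\<bar> \<le> M"
  shows "\<bar>jacobi01_inner \<alpha> v (poly (jacobi01 \<alpha> k))\<bar> \<le> M * sqrt (jacobi01_inner \<alpha> (poly (jacobi01 \<alpha> k)) (poly (jacobi01 \<alpha> k)))"
proof -
  define p where "p = jacobi01 \<alpha> k"
  define h where "h = jacobi01_inner \<alpha> (poly p) (poly p)"
  define s where "s = sqrt h / M"
  define w where "w = beta_weight \<alpha> \<alpha>"
  have h: "h > 0" unfolding h_def p_def by (rule jacobi01_norm_pos[OF \<alpha>])
  have s: "s > 0" using h M by (simp add: s_def)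
  have pp: "(\<lambda>t. poly p t * poly p t * w t) integrable_on {0..1}"
    unfolding w_def using \<alpha> by (intro integrable_continuous_real continuous_intros) auto
  have "\<bar>jacobi01_inner \<alpha> v (poly p)\<bar> \<le> integral {0..1} (\<lambda>t. s / 2 * M\<^sup>2 + 1 / (2 * s) * (poly p t * poly p t * w t))"
    unfolding jacobi01_inner_def w_def[symmetric]
  proof (rule integral_norm_bound_integral[where f = "\<lambda>t. v t * poly p t * w t", simplified real_norm_def])
    show "(\<lambda>t. v t * poly p t * w t) integrable_on {0..1}"
      unfolding w_def using \<alpha> v by (intro integrable_continuous_real continuous_intros) auto
    show "(\<lambda>t. s / 2 * M\<^sup>2 + 1 / (2 * s) * (poly p t * poly p t * w t)) integrable_on {0..1}"
      by (intro integrable_add integrable_on_mult_right pp integrable_const_ivl)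
    fix t :: real assume t: "t \<in> {0..1}"
    define y where "y = \<bar>poly p t\<bar>"
    have w: "0 \<le> w t" "w t \<le> 1"
      using t \<alpha> by (auto simp: w_def intro!: beta_weight_nonneg beta_weight_le_1)
    have "0 \<le> (s * M - y)\<^sup>2" by simp
    hence amgm: "M * y \<le> s / 2 * M\<^sup>2 + 1 / (2 * s) * y\<^sup>2"
      using s by (simp add: power2_diff field_simps power2_eq_square)
    have "\<bar>v t * poly p t * w t\<bar> = \<bar>v t\<bar> * y * w t"
      using w by (simp add: abs_mult y_def)
    also have "\<dots> \<le> M * y * w t"
      using M(2)[OF t] w by (intro mult_right_mono) (auto simp: y_def)
    also have "\<dots> \<le> (s / 2 * M\<^sup>2 + 1 / (2 * s) * y\<^sup>2) * w t"
      using amgm w by (intro mult_right_mono) auto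
    also have "\<dots> = s / 2 * M\<^sup>2 * w t + 1 / (2 * s) * (y\<^sup>2 * w t)"
      by (simp add: algebra_simps)
    also have "\<dots> \<le> s / 2 * M\<^sup>2 * 1 + 1 / (2 * s) * (y\<^sup>2 * w t)"
      using w s by (intro add_mono mult_left_mono) auto
    also have "y\<^sup>2 = poly p t * poly p t" by (simp add: y_def power2_eq_square)
    finally show "\<bar>v t * poly p t * w t\<bar> \<le> s / 2 * M\<^sup>2 + 1 / (2 * s) * (poly p t * poly p t * w t)"
      by simp
  qed
  also have "\<dots> = integral {0..1} (\<lambda>t::real. s / 2 * M\<^sup>2) + integral {0..1} (\<lambda>t. 1 / (2 * s) * (poly p t * poly p t * w t))"
    by (rule Henstock_Kurzweil_Integration.integral_add[OF integrable_const_ivl integrable_on_mult_right[OF pp]])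
  also have "\<dots> = s / 2 * M\<^sup>2 + 1 / (2 * s) * h"
    by (simp add: h_def jacobi01_inner_def w_def)
  also have "\<dots> = M * sqrt h"
  proof -
    have "1 / (2 * s) * (sqrt h * sqrt h) = M * sqrt h / 2"
      unfolding s_def using h M(1) by (simp add: field_simps del: real_sqrt_mult_self)
    hence "1 / (2 * s) * h = M * sqrt h / 2" using h by simp
    moreover have "s / 2 * M\<^sup>2 = M * sqrt h / 2"
      unfolding s_def using M(1) by (simp add: power2_eq_square)
    ultimately show ?thesis by simp
  qed
  finally show ?thesis by (simp add: h_def p_def)
qed

section \<open>The two expansions stay close\<close>

text \<open>
  The largeness condition on \<open>N\<close> ensures \<open>n \<le> N\<close> and \<open>6 \<lambda>\<^sub>k \<le> N\<close> for \<open>k \<le> n\<close>, so that \<open>hahn_poly_close\<close>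
  applies to every term. With \<open>\<nu> = n + 1\<close>, the error in the coefficient contributes a multiple of
  \<open>\<nu> powr (2\<alpha> + 2) / N\<close> to each term, and the error in the polynomial a multiple of
  \<open>\<nu> powr (\<alpha> + 5/2) / N\<close>; there are \<open>\<nu>\<close> terms.
\<close>

lemma hahn_jacobi_difference:
  assumes \<alpha>: "\<alpha> \<ge> 0" and u: "continuous_on {- 1..1} u" "u \<in> BV (- 1) 1"
  defines "\<beta> \<equiv> 3 + \<alpha> + max 1 \<alpha>"
  obtains A where "\<And>n N x. N > 0 \<Longrightarrow> 6 * (2 * \<alpha> + 1) * (real n + 1) powr \<beta> \<le> real N \<Longrightarrow> x \<in> {- 1..1} \<Longrightarrow>
     \<bar>hahn_sum \<alpha> N u n x - jacobi_sum \<alpha> u n x\<bar> \<le> A * ((real n + 1) powr \<beta> / real N)"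
proof -
  define v where "v = (\<lambda>t. u (2 * t - 1))"
  define p where "p = (\<lambda>k. jacobi01 \<alpha> k)"
  define h where "h = (\<lambda>k. jacobi01_inner \<alpha> (poly (p k)) (poly (p k)))"
  define ev where "ev = (\<lambda>k. jacobi_eigenvalue \<alpha> k)"
  have v: "continuous_on {0..1} v"
    unfolding v_def by (rule continuous_on_compose2[OF u(1)]) (auto intro!: continuous_intros)
  obtain M where M: "M > 0" "\<And>t. t \<in> {0..1} \<Longrightarrow> \<bar>v t\<bar> \<le> M"
    using compact_imp_bounded[OF compact_continuous_image[OF v compact_Icc]]
    unfolding bounded_pos by auto
  obtain V where V: "\<And>n t. t 0 = - 1 \<Longrightarrow> t n = 1 \<Longrightarrow> (\<And>i. i < n \<Longrightarrow> t i < t (Suc i)) \<Longrightarrow>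
       (\<Sum>i<n. \<bar>u (t (Suc i)) - u (t i)\<bar>) \<le> V"
    by (rule BV_bound[OF u(2)]) blast
  have V0: "V \<ge> 0" using V[of "\<lambda>i. 2 * real i - 1" 1] by simp
  obtain C where C: "C > 0" "\<And>k. 1 / h k \<le> C * (real k + 1) powr (2 * \<alpha> + 1)"
    using jacobi01_norm_lower_bound[OF \<alpha>] unfolding h_def p_def by metis
  define a where "a = 2 * \<alpha> + 1"
  have a: "a \<ge> 1" using \<alpha> by (simp add: a_def)
  define A where "A = 3 * V * (\<alpha> + a + 2) * C + 12 * M * sqrt C * a"
  have h: "h k > 0" for k unfolding h_def p_def by (rule jacobi01_norm_pos[OF \<alpha>])
  show ?thesis
  proof (rule that[of A])
    fix n N :: nat and x :: real
    assume N: "N > 0" and large: "6 * (2 * \<alpha> + 1) * (real n + 1) powr \<beta> \<le> real N" and x: "x \<in> {- 1..1}"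
    define \<nu> where "\<nu> = real n + 1"
    define t where "t = (1 + x) / 2"
    have t: "t \<in> {0..1}" using x by (auto simp: t_def)
    have \<nu>: "\<nu> \<ge> 1" by (simp add: \<nu>_def)
    have ev: "ev k \<ge> 0" "ev k \<le> a * \<nu>\<^sup>2" if "k \<le> n" for k
    proof -
      show "ev k \<ge> 0" using eigenvalue_nonneg[OF \<alpha>] by (simp add: ev_def)
      have "2 * \<alpha> \<le> 2 * \<alpha> * \<nu>" using \<alpha> \<nu> by (simp add: mult_le_cancel_left1)
      hence "real k + 2 * \<alpha> + 1 \<le> a * \<nu>" using that by (simp add: a_def \<nu>_def algebra_simps)
      hence "real k * (real k + 2 * \<alpha> + 1) \<le> \<nu> * (a * \<nu>)"
        using that \<alpha> by (intro mult_mono) (auto simp: \<nu>_def)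
      thus "ev k \<le> a * \<nu>\<^sup>2" by (simp add: ev_def jacobi_eigenvalue_def power2_eq_square mult_ac)
    qed
    have "\<nu>\<^sup>2 \<le> \<nu> powr \<beta>"
    proof -
      have "\<nu>\<^sup>2 = \<nu> powr 2" using \<nu> by simp
      also have "\<dots> \<le> \<nu> powr \<beta>" using \<nu> \<alpha> by (intro powr_mono) (auto simp: \<beta>_def)
      finally show ?thesis .
    qed
    hence "6 * (a * \<nu>\<^sup>2) \<le> 6 * (a * \<nu> powr \<beta>)" using a by (intro mult_left_mono) auto
    also have "\<dots> \<le> real N" using large unfolding a_def \<nu>_def by (simp only: mult.assoc)
    finally have sq: "6 * (a * \<nu>\<^sup>2) \<le> real N" .
    have ev_N: "6 * jacobi_eigenvalue \<alpha> k \<le> real N" if "k \<le> n" for k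
      using ev(2)[OF that] sq unfolding ev_def by linarith
    have "\<nu> \<le> \<nu>\<^sup>2" using \<nu> by (simp add: power2_eq_square)
    moreover have "\<nu>\<^sup>2 \<le> a * \<nu>\<^sup>2" using a by (simp add: mult_le_cancel_right1)
    ultimately have "real n \<le> real N" using sq \<nu> unfolding \<nu>_def by linarith
    hence kN: "k \<le> N" if "k \<le> n" for k using that by simp
    define B where "B = bernstein_op N (\<lambda>i. v (real i / real N))"
    have x_eq: "real N / 2 * (1 + x) = real N * t" by (simp add: t_def)
    define Q where "Q = (\<lambda>k. hahn_poly \<alpha> \<alpha> N k (real N * t))"
    have grid: "on_grid N u = (\<lambda>i. v (real i / real N))"
      by (simp add: fun_eq_iff on_grid_def v_def)
    have "hahn_sum \<alpha> N u n x = (\<Sum>k\<le>n. jacobi01_inner \<alpha> B (poly (p k)) / h k * Q k)"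
      unfolding hahn_sum_def x_eq grid
    proof (intro sum.cong refl)
      fix k assume "k \<in> {..n}"
      hence k: "k \<le> n" by simp
      have "beta_sample \<alpha> N (poly (jacobi01 \<alpha> k)) 0 \<noteq> 0"
        using hahn_poly_close(1)[OF \<alpha> kN[OF k] N ev_N[OF k] t] by simp
      from hahn_coefficient[OF \<alpha> kN[OF k] this]
      show "hahn_inner \<alpha> N (\<lambda>i. v (real i / real N)) (\<lambda>i. hahn_poly \<alpha> \<alpha> N k (real i))
          / hahn_inner \<alpha> N (\<lambda>i. hahn_poly \<alpha> \<alpha> N k (real i)) (\<lambda>i. hahn_poly \<alpha> \<alpha> N k (real i))
          * hahn_poly \<alpha> \<alpha> N k (real N * t) = jacobi01_inner \<alpha> B (poly (p k)) / h k * Q k"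
        by (simp add: B_def p_def h_def Q_def)
    qed
    moreover have "jacobi_sum \<alpha> u n x = (\<Sum>k\<le>n. jacobi01_inner \<alpha> v (poly (p k)) / h k * poly (p k) t)"
      using jacobi_sum_eq[OF \<alpha> v[unfolded v_def], of n x] by (simp add: v_def p_def h_def t_def)
    ultimately have "hahn_sum \<alpha> N u n x - jacobi_sum \<alpha> u n x =
        (\<Sum>k\<le>n. jacobi01_inner \<alpha> B (poly (p k)) / h k * Q k - jacobi01_inner \<alpha> v (poly (p k)) / h k * poly (p k) t)"
      by (simp add: sum_subtractf)
    also have "\<bar>\<dots>\<bar> \<le> (\<Sum>k\<le>n. A * (\<nu> powr (\<beta> - 1) / real N))"
    proof (intro order.trans[OF sum_abs] sum_mono)
      fix k assume "k \<in> {..n}"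
      hence k: "k \<le> n" by simp
      have inv_h: "1 / h k \<le> C * \<nu> powr (2 * \<alpha> + 1)"
      proof -
        have "(real k + 1) powr (2 * \<alpha> + 1) \<le> \<nu> powr (2 * \<alpha> + 1)"
          using k \<alpha> by (intro powr_mono2) (auto simp: \<nu>_def)
        thus ?thesis using C(2)[of k] C(1) by (meson less_imp_le mult_left_mono order.trans)
      qed
      have inv_sqrt_h: "1 / sqrt (h k) \<le> sqrt C * \<nu> powr (\<alpha> + 1 / 2)"
      proof -
        have "1 / sqrt (h k) = sqrt (1 / h k)" by (simp add: real_sqrt_divide)
        also have "\<dots> \<le> sqrt (C * \<nu> powr (2 * \<alpha> + 1))" using inv_h by simp
        also have "\<dots> = sqrt C * \<nu> powr ((2 * \<alpha> + 1) / 2)"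
          using powr_half_sqrt[of "\<nu> powr (2 * \<alpha> + 1)"] by (simp add: real_sqrt_mult powr_powr)
        also have "(2 * \<alpha> + 1) / 2 = \<alpha> + 1 / 2" by simp
        finally show ?thesis .
      qed
      have "jacobi01_inner \<alpha> B (poly (p k)) / h k * Q k - jacobi01_inner \<alpha> v (poly (p k)) / h k * poly (p k) t =
          (jacobi01_inner \<alpha> B (poly (p k)) - jacobi01_inner \<alpha> v (poly (p k))) * (1 / h k) * Q k
          + jacobi01_inner \<alpha> v (poly (p k)) * (1 / h k) * (Q k - poly (p k) t)"
        by (simp add: algebra_simps diff_divide_distrib)
      also have "\<bar>\<dots>\<bar> \<le> \<bar>jacobi01_inner \<alpha> B (poly (p k)) - jacobi01_inner \<alpha> v (poly (p k))\<bar> * (1 / h k) * \<bar>Q k\<bar>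
          + \<bar>jacobi01_inner \<alpha> v (poly (p k))\<bar> * (1 / h k) * \<bar>Q k - poly (p k) t\<bar>"
        using h[of k] by (intro order.trans[OF abs_triangle_ineq]) (simp add: abs_mult)
      also have "\<bar>jacobi01_inner \<alpha> B (poly (p k)) - jacobi01_inner \<alpha> v (poly (p k))\<bar> * (1 / h k) * \<bar>Q k\<bar> \<le>
          (V * ((\<alpha> + a + 2) * \<nu>) / real N) * (C * \<nu> powr (2 * \<alpha> + 1)) * 3"
      proof (intro mult_mono inv_h)
        have "sqrt (ev k) \<le> sqrt ((a * \<nu>)\<^sup>2)"
        proof (rule real_sqrt_le_mono)
          have "a * \<nu>\<^sup>2 \<le> a\<^sup>2 * \<nu>\<^sup>2" using a by (intro mult_right_mono) (auto simp: power2_eq_square)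
          thus "ev k \<le> (a * \<nu>)\<^sup>2" using ev(2)[OF k] by (simp add: power_mult_distrib)
        qed
        hence sqrt_ev: "sqrt (ev k) \<le> a * \<nu>" using a \<nu> by simp
        have "\<bar>jacobi01_inner \<alpha> B (poly (p k)) - jacobi01_inner \<alpha> v (poly (p k))\<bar> \<le> V * (\<alpha> + sqrt (ev k) + 2) / real N"
          unfolding B_def p_def ev_def
          by (rule bernstein_quadrature[where u = u])
             (fact \<alpha> jacobi01_abs_le_1[OF \<alpha>] jacobi01_bernstein_inequality[OF \<alpha>] V N v | simp add: v_def)+
        also have "\<dots> \<le> V * ((\<alpha> + a + 2) * \<nu>) / real N"
        proof (intro divide_right_mono mult_left_mono V0)
          have "(\<alpha> + 2) * 1 \<le> (\<alpha> + 2) * \<nu>" using \<alpha> \<nu> by (intro mult_left_mono) auto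
          thus "\<alpha> + sqrt (ev k) + 2 \<le> (\<alpha> + a + 2) * \<nu>" using sqrt_ev by (simp add: algebra_simps)
        qed auto
        finally show "\<bar>jacobi01_inner \<alpha> B (poly (p k)) - jacobi01_inner \<alpha> v (poly (p k))\<bar> \<le> V * ((\<alpha> + a + 2) * \<nu>) / real N" .
        show "\<bar>Q k\<bar> \<le> 3" unfolding Q_def by (rule hahn_poly_close(2)[OF \<alpha> kN[OF k] N ev_N[OF k] t])
      qed (use V0 \<alpha> a \<nu> h[of k] C(1) in auto)
      also have "\<bar>jacobi01_inner \<alpha> v (poly (p k))\<bar> * (1 / h k) * \<bar>Q k - poly (p k) t\<bar> \<le>
          (M * (sqrt C * \<nu> powr (\<alpha> + 1 / 2))) * (12 * (a * \<nu>\<^sup>2) / real N)"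
      proof (rule mult_mono)
        have "\<bar>jacobi01_inner \<alpha> v (poly (p k))\<bar> \<le> M * sqrt (h k)"
          unfolding h_def p_def by (rule jacobi01_inner_jacobi_bound[OF \<alpha> v M])
        hence "\<bar>jacobi01_inner \<alpha> v (poly (p k))\<bar> * (1 / h k) \<le> M * sqrt (h k) * (1 / h k)"
          using h[of k] by (intro mult_right_mono) auto
        also have "\<dots> = M * (1 / sqrt (h k))"
          using h[of k] by (simp add: real_div_sqrt field_simps)
        also have "\<dots> \<le> M * (sqrt C * \<nu> powr (\<alpha> + 1 / 2))"
          using M(1) by (intro mult_left_mono inv_sqrt_h) auto
        finally show "\<bar>jacobi01_inner \<alpha> v (poly (p k))\<bar> * (1 / h k) \<le> M * (sqrt C * \<nu> powr (\<alpha> + 1 / 2))" .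
        have "\<bar>Q k - poly (p k) t\<bar> \<le> 12 * ev k / real N"
          unfolding Q_def p_def ev_def by (rule hahn_poly_close(3)[OF \<alpha> kN[OF k] N ev_N[OF k] t])
        also have "\<dots> \<le> 12 * (a * \<nu>\<^sup>2) / real N"
          using ev(2)[OF k] by (intro divide_right_mono) auto
        finally show "\<bar>Q k - poly (p k) t\<bar> \<le> 12 * (a * \<nu>\<^sup>2) / real N" .
      qed (use M(1) C(1) in auto)
      also have "(V * ((\<alpha> + a + 2) * \<nu>) / real N) * (C * \<nu> powr (2 * \<alpha> + 1)) * 3
          + (M * (sqrt C * \<nu> powr (\<alpha> + 1 / 2))) * (12 * (a * \<nu>\<^sup>2) / real N) =
          (3 * V * (\<alpha> + a + 2) * C) * (\<nu> powr (2 * \<alpha> + 2) / real N)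
          + (12 * M * sqrt C * a) * (\<nu> powr (\<alpha> + 5 / 2) / real N)"
      proof -
        have e\<^sub>1: "\<nu> * \<nu> powr (2 * \<alpha> + 1) = \<nu> powr (2 * \<alpha> + 2)"
          using \<nu> powr_add[of \<nu> 1 "2 * \<alpha> + 1"] by (simp add: add_ac)
        have e\<^sub>2: "\<nu> powr (\<alpha> + 1 / 2) * \<nu>\<^sup>2 = \<nu> powr (\<alpha> + 5 / 2)"
        proof -
          have "\<nu> powr (\<alpha> + 1 / 2) * \<nu>\<^sup>2 = \<nu> powr (\<alpha> + 1 / 2) * \<nu> powr 2" using \<nu> by simp
          also have "\<dots> = \<nu> powr (\<alpha> + 1 / 2 + 2)" by (rule powr_add[symmetric])
          also have "\<alpha> + 1 / 2 + 2 = \<alpha> + 5 / 2" by simp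
          finally show ?thesis .
        qed
        show ?thesis
          unfolding e\<^sub>1[symmetric] e\<^sub>2[symmetric] by (simp only: divide_inverse mult_ac)
      qed
      also have "\<dots> \<le> (3 * V * (\<alpha> + a + 2) * C) * (\<nu> powr (\<beta> - 1) / real N)
          + (12 * M * sqrt C * a) * (\<nu> powr (\<beta> - 1) / real N)"
        using V0 \<alpha> a C(1) M(1) \<nu>
        by (intro add_mono mult_left_mono divide_right_mono powr_mono) (auto simp: \<beta>_def)
      also have "\<dots> = A * (\<nu> powr (\<beta> - 1) / real N)"
        by (simp add: A_def algebra_simps)
      finally show "\<bar>jacobi01_inner \<alpha> B (poly (p k)) / h k * Q k - jacobi01_inner \<alpha> v (poly (p k)) / h k * poly (p k) t\<bar>
          \<le> A * (\<nu> powr (\<beta> - 1) / real N)"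
        by this simp_all
    qed
    also have "(\<Sum>k\<le>n. A * (\<nu> powr (\<beta> - 1) / real N)) = A * (\<nu> * \<nu> powr (\<beta> - 1) / real N)"
      by (simp add: \<nu>_def add_ac)
    also have "\<nu> * \<nu> powr (\<beta> - 1) = \<nu> powr \<beta>"
      using \<nu> powr_add[of \<nu> 1 "\<beta> - 1"] by simp
    finally show "\<bar>hahn_sum \<alpha> N u n x - jacobi_sum \<alpha> u n x\<bar> \<le> A * ((real n + 1) powr \<beta> / real N)"
      by (simp add: \<nu>_def)
  qed
qed

text \<open>
  The bound of \<open>hahn_jacobi_difference\<close> contains \<open>n + 1\<close> instead of \<open>n\<close>, which changes the rate by at most
  the factor \<open>2 powr \<beta>\<close>.
\<close>

theorem theorem1p2:
  fixes \<alpha> :: real and u :: "real \<Rightarrow> real" and N :: "nat \<Rightarrow> nat"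
  assumes "\<alpha> \<ge> 0"
    and "continuous_on {-1..1} u"
    and "u \<in> BV (-1) 1"
    and "\<And>n. N n > 0"
    and "(\<lambda>n. real n powr (3 + \<alpha> + max 1 \<alpha>) / real (N n)) \<longlonglongrightarrow> 0"
  shows "\<forall>x\<in>{-1..1}. (\<lambda>n. jacobi_sum \<alpha> u n x) \<longlonglongrightarrow> u x
           \<longrightarrow> (\<lambda>n. hahn_sum \<alpha> (N n) u n x) \<longlonglongrightarrow> u x"
proof (intro ballI impI)
  fix x :: real assume x: "x \<in> {-1..1}" and conv: "(\<lambda>n. jacobi_sum \<alpha> u n x) \<longlonglongrightarrow> u x"
  define \<beta> where "\<beta> = 3 + \<alpha> + max 1 \<alpha>"
  define r where "r = (\<lambda>n. (real n + 1) powr \<beta> / real (N n))"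
  obtain A where A: "\<And>n N x. N > 0 \<Longrightarrow> 6 * (2 * \<alpha> + 1) * (real n + 1) powr \<beta> \<le> real N \<Longrightarrow> x \<in> {- 1..1} \<Longrightarrow>
     \<bar>hahn_sum \<alpha> N u n x - jacobi_sum \<alpha> u n x\<bar> \<le> A * ((real n + 1) powr \<beta> / real N)"
    using hahn_jacobi_difference[OF assms(1-3)] unfolding \<beta>_def by metis
  have "(\<lambda>n. 2 powr \<beta> * (real n powr \<beta> / real (N n))) \<longlonglongrightarrow> 0"
    using tendsto_mult_left[OF assms(5), of "2 powr \<beta>"] by (simp add: \<beta>_def)
  moreover have "\<forall>\<^sub>F n in sequentially. norm (r n) \<le> 2 powr \<beta> * (real n powr \<beta> / real (N n))"
    using eventually_ge_at_top[of 1]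
  proof eventually_elim
    case (elim n)
    have "(real n + 1) powr \<beta> \<le> (2 * real n) powr \<beta>"
      using elim assms(1) by (intro powr_mono2) (auto simp: \<beta>_def)
    also have "\<dots> = 2 powr \<beta> * real n powr \<beta>" by (simp add: powr_mult)
    finally show ?case by (simp add: r_def divide_right_mono)
  qed
  ultimately have r: "r \<longlonglongrightarrow> 0"
    by (rule Lim_null_comparison[rotated])
  have "0 < 1 / (6 * (2 * \<alpha> + 1))" using assms(1) by simp
  from order_tendstoD(2)[OF r this]
  have "\<forall>\<^sub>F n in sequentially. norm (hahn_sum \<alpha> (N n) u n x - jacobi_sum \<alpha> u n x) \<le> A * r n"
  proof eventually_elim
    case (elim n)
    have "6 * (2 * \<alpha> + 1) * (real n + 1) powr \<beta> \<le> real (N n)"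
      using elim assms(1) assms(4)[of n] by (simp add: r_def field_simps)
    from A[OF assms(4) this x] show ?case by (simp add: r_def)
  qed
  moreover have "(\<lambda>n. A * r n) \<longlonglongrightarrow> 0" using tendsto_mult_left[OF r, of A] by simp
  ultimately have "(\<lambda>n. hahn_sum \<alpha> (N n) u n x - jacobi_sum \<alpha> u n x) \<longlonglongrightarrow> 0"
    by (rule Lim_null_comparison)
  from tendsto_add[OF this conv] show "(\<lambda>n. hahn_sum \<alpha> (N n) u n x) \<longlonglongrightarrow> u x" by simp
qed

end
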